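(* Let $I$ be a closed ideal of $A(H)$. If $\rho_*(I)$ is an ideal of multiplicity, then $I$ is also an ideal of multiplicity.
   Context: Let $G,H$ be locally compact second countable groups with Haar measures $\mu,\nu$, and $\theta:G\to H$ a continuous homomorphism with $\theta_*(\mu)(\alpha)=\mu(\theta^{-1}(\alpha))$ absolutely continuous with respect to $\nu$; $H_0=\theta(G)$ is an open subgroup of $H$. Standing assumption: $\theta_*(\mu)(\alpha)=\nu(\alpha)$ for all Borel $\alpha\subseteq H_0$. Then $\rho(u)=u\circ\theta$ defines a continuous homomorphism between the Fourier algebras $A(H)\to A(G)$; $\rho_*(I)$ is the closed ideal of $A(G)$ generated by $\rho(I)$. A closed ideal $J$ of the Fourier algebra $A(K)$ is an ideal of multiplicity if $J^\perp\cap C^*_r(K)\neq\{0\}$, where $J^\perp$ is its annihilator in $VN(K)$ and $C^*_r(K)$ the reduced group $C^*$-algebra. *)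

theory Defs
  imports "HOL-Analysis.Analysis"
begin

text \<open>Groups are written additively (class group_add does NOT assume commutativity):
  the product x y is x + y, the inverse x^{-1} is - x.\<close>

definition lcsc_group :: "'a::{topological_group_add, t2_space, second_countable_topology} itself \<Rightarrow> bool" where
  "lcsc_group _ \<longleftrightarrow> locally_compact_space (euclidean :: 'a topology)"

text \<open>Left Haar measure (on a second countable LC group every Borel measure finite on
  compacts is Radon, so no separate regularity condition is needed).\<close>
definition haar_measure :: "'a::{topological_group_add, t2_space, second_countable_topology} measure \<Rightarrow> bool" where
  "haar_measure \<mu> \<longleftrightarrow> sets \<mu> = sets borel
     \<and> (\<forall>A\<in>sets borel. \<forall>x. emeasure \<mu> ((\<lambda>y. x + y) ` A) = emeasure \<mu> A)
     \<and> (\<forall>K. compact K \<longrightarrow> emeasure \<mu> K < \<infinity>)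
     \<and> (\<forall>U. open U \<and> U \<noteq> {} \<longrightarrow> emeasure \<mu> U > 0)"

definition L2 :: "'a measure \<Rightarrow> ('a \<Rightarrow> complex) set" where
  "L2 M = {f. f \<in> borel_measurable M \<and> integrable M (\<lambda>x. (cmod (f x))\<^sup>2)}"

definition l2inner :: "'a measure \<Rightarrow> ('a \<Rightarrow> complex) \<Rightarrow> ('a \<Rightarrow> complex) \<Rightarrow> complex" where
  "l2inner M f g = (LINT x|M. f x * cnj (g x))"

definition l2norm :: "'a measure \<Rightarrow> ('a \<Rightarrow> complex) \<Rightarrow> real" where
  "l2norm M f = sqrt (LINT x|M. (cmod (f x))\<^sup>2)"

definition left_transl :: "'a::group_add \<Rightarrow> ('a \<Rightarrow> complex) \<Rightarrow> ('a \<Rightarrow> complex)" where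
  "left_transl x f = (\<lambda>y. f (- x + y))"

definition bdd_op :: "'a measure \<Rightarrow> (('a \<Rightarrow> complex) \<Rightarrow> ('a \<Rightarrow> complex)) \<Rightarrow> bool" where
  "bdd_op M T \<longleftrightarrow>
     (\<forall>f\<in>L2 M. T f \<in> L2 M)
   \<and> (\<forall>f\<in>L2 M. \<forall>g\<in>L2 M. (AE x in M. f x = g x) \<longrightarrow> (AE x in M. T f x = T g x))
   \<and> (\<forall>f\<in>L2 M. \<forall>g\<in>L2 M. \<forall>c. AE x in M. T (\<lambda>y. f y + c * g y) x = T f x + c * T g x)
   \<and> (\<exists>C. \<forall>f\<in>L2 M. l2norm M (T f) \<le> C * l2norm M f)"

definition op_norm :: "'a measure \<Rightarrow> (('a \<Rightarrow> complex) \<Rightarrow> ('a \<Rightarrow> complex)) \<Rightarrow> real" where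
  "op_norm M T = Sup {l2norm M (T f) | f. f \<in> L2 M \<and> l2norm M f \<le> 1}"

definition lambda_span :: "'a::group_add measure \<Rightarrow> (('a \<Rightarrow> complex) \<Rightarrow> ('a \<Rightarrow> complex)) set" where
  "lambda_span M = {S. \<exists>(n::nat) (c::nat \<Rightarrow> complex) (x::nat \<Rightarrow> 'a).
       S = (\<lambda>f y. \<Sum>i<n. c i * left_transl (x i) f y)}"

definition VN :: "'a::group_add measure \<Rightarrow> (('a \<Rightarrow> complex) \<Rightarrow> ('a \<Rightarrow> complex)) set" where
  "VN M = {T. bdd_op M T \<and>
     (\<forall>(n::nat) f g. (\<forall>i<n. f i \<in> L2 M \<and> g i \<in> L2 M) \<longrightarrow>
        (\<forall>\<epsilon>>0. \<exists>S\<in>lambda_span M. \<forall>i<n.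
            cmod (l2inner M (T (f i)) (g i) - l2inner M (S (f i)) (g i)) < \<epsilon>))}"

definition conv_op :: "'a::group_add measure \<Rightarrow> ('a \<Rightarrow> complex) \<Rightarrow> ('a \<Rightarrow> complex) \<Rightarrow> ('a \<Rightarrow> complex)" where
  "conv_op M h f = (\<lambda>y. LINT x|M. h x * f (- x + y))"

definition Cr :: "'a::group_add measure \<Rightarrow> (('a \<Rightarrow> complex) \<Rightarrow> ('a \<Rightarrow> complex)) set" where
  "Cr M = {T. bdd_op M T \<and>
     (\<forall>\<epsilon>>0. \<exists>h. integrable M h \<and> op_norm M (\<lambda>f y. T f y - conv_op M h f y) < \<epsilon>)}"

definition coef :: "'a::group_add measure \<Rightarrow> ('a \<Rightarrow> complex) \<Rightarrow> ('a \<Rightarrow> complex) \<Rightarrow> ('a \<Rightarrow> complex)" where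
  "coef M f g = (\<lambda>x. l2inner M (left_transl x f) g)"

definition A_rep :: "'a::group_add measure \<Rightarrow> ('a \<Rightarrow> complex) \<Rightarrow> (nat \<Rightarrow> 'a \<Rightarrow> complex) \<Rightarrow> (nat \<Rightarrow> 'a \<Rightarrow> complex) \<Rightarrow> bool" where
  "A_rep M u f g \<longleftrightarrow> (\<forall>n. f n \<in> L2 M \<and> g n \<in> L2 M)
     \<and> summable (\<lambda>n. l2norm M (f n) * l2norm M (g n))
     \<and> (\<forall>x. (\<lambda>n. coef M (f n) (g n) x) sums u x)"

definition fourier_alg :: "'a::group_add measure \<Rightarrow> ('a \<Rightarrow> complex) set" where
  "fourier_alg M = {u. \<exists>f g. A_rep M u f g}"

definition A_norm :: "'a::group_add measure \<Rightarrow> ('a \<Rightarrow> complex) \<Rightarrow> real" where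
  "A_norm M u = Inf {(\<Sum>n. l2norm M (f n) * l2norm M (g n)) | f g. A_rep M u f g}"

definition closed_ideal :: "'a::group_add measure \<Rightarrow> ('a \<Rightarrow> complex) set \<Rightarrow> bool" where
  "closed_ideal M J \<longleftrightarrow> J \<subseteq> fourier_alg M \<and> (\<lambda>_. 0) \<in> J
     \<and> (\<forall>u\<in>J. \<forall>v\<in>J. (\<lambda>x. u x + v x) \<in> J)
     \<and> (\<forall>u\<in>J. \<forall>c. (\<lambda>x. c * u x) \<in> J)
     \<and> (\<forall>u\<in>J. \<forall>v\<in>fourier_alg M. (\<lambda>x. v x * u x) \<in> J)
     \<and> (\<forall>u\<in>fourier_alg M. (\<forall>\<epsilon>>0. \<exists>v\<in>J. A_norm M (\<lambda>x. u x - v x) < \<epsilon>) \<longrightarrow> u \<in> J)"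

text \<open>Annihilator of J in VN(G) w.r.t. the duality <T, u> = sum_n <T f_n, g_n>
  for u = sum_n <lambda(.) f_n, g_n>.\<close>
definition annihilator :: "'a::group_add measure \<Rightarrow> ('a \<Rightarrow> complex) set \<Rightarrow> (('a \<Rightarrow> complex) \<Rightarrow> ('a \<Rightarrow> complex)) set" where
  "annihilator M J = {T \<in> VN M. \<forall>u\<in>J. \<forall>f g. A_rep M u f g \<longrightarrow>
      (\<Sum>n. l2inner M (T (f n)) (g n)) = 0}"

definition nonzero_op :: "'a measure \<Rightarrow> (('a \<Rightarrow> complex) \<Rightarrow> ('a \<Rightarrow> complex)) \<Rightarrow> bool" where
  "nonzero_op M T \<longleftrightarrow> (\<exists>f\<in>L2 M. \<exists>g\<in>L2 M. l2inner M (T f) g \<noteq> 0)"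

definition ideal_of_multiplicity :: "'a::group_add measure \<Rightarrow> ('a \<Rightarrow> complex) set \<Rightarrow> bool" where
  "ideal_of_multiplicity M J \<longleftrightarrow> (\<exists>T\<in>annihilator M J \<inter> Cr M. nonzero_op M T)"

definition rho_star :: "'g::group_add measure \<Rightarrow> ('g \<Rightarrow> 'h) \<Rightarrow> ('h \<Rightarrow> complex) set \<Rightarrow> ('g \<Rightarrow> complex) set" where
  "rho_star \<mu> \<theta> I = \<Inter>{J. closed_ideal \<mu> J \<and> (\<lambda>u. u \<circ> \<theta>) ` I \<subseteq> J}"

end

theory Submission
  imports Defs
begin

text \<open>
  Take \<open>T \<in> C\<^sup>*\<^sub>r(G)\<close> annihilating \<open>\<rho>\<^sub>*(I)\<close> with \<open>\<langle>T f, g\<rangle> \<noteq> 0\<close>, where \<open>f\<close> and \<open>g\<close> vanish outside a compact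
  set, and let \<open>u(x) = \<langle>\<lambda>(x) f, g\<rangle>\<close>. The sought operator \<open>S\<close> on \<open>L\<^sup>2(H)\<close> is characterised by
  \<open>\<langle>S, v\<rangle> = \<langle>T, u (v \<circ> \<theta>)\<rangle>\<close>, so it annihilates \<open>I\<close> because \<open>u (v \<circ> \<theta>) \<in> \<rho>\<^sub>*(I)\<close> for \<open>v \<in> I\<close>. If \<open>v\<close> is a
  coefficient function equal to 1 on the compact image of the support of \<open>u\<close>, then
  \<open>\<langle>S, v\<rangle> = \<langle>T, u\<rangle> = \<langle>T f, g\<rangle> \<noteq> 0\<close>.

  To construct \<open>S\<close>, approximate \<open>T\<close> in norm by \<open>\<lambda>(k\<^sub>n)\<close> with \<open>k\<^sub>n \<in> L\<^sup>1(G)\<close> and let \<open>m\<^sub>n\<close> be the density of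
  \<open>\<theta>\<^sub>*(u k\<^sub>n)\<close> with respect to \<open>\<nu>\<close>. Fell's absorption principle writes \<open>u (v \<circ> \<theta>)\<close>, for a coefficient
  function \<open>v\<close> of the regular representation of \<open>H\<close>, as an integral over \<open>H\<close> of coefficient functions of
  the regular representation of \<open>G\<close>; hence \<open>\<parallel>\<lambda>(m\<^sub>i) - \<lambda>(m\<^sub>j)\<parallel> \<le> \<parallel>f\<parallel> \<parallel>g\<parallel> \<parallel>\<lambda>(k\<^sub>i) - \<lambda>(k\<^sub>j)\<parallel>\<close>, and \<open>S\<close> is the
  norm limit of \<open>\<lambda>(m\<^sub>n)\<close>.
\<close>

section \<open>Square-integrable functions\<close>

lemma borel_measurable_cnj [measurable (raw)]:
  "f \<in> borel_measurable M \<Longrightarrow> (\<lambda>x. cnj (f x)) \<in> borel_measurable M"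
  using measurable_compose[OF _ borel_measurable_continuous_onI[OF continuous_on_cnj[OF continuous_on_id]]]
  by auto

lemma L2_measurable [measurable_dest]: "f \<in> L2 M \<Longrightarrow> f \<in> borel_measurable M"
  by (simp add: L2_def)

lemma L2_integrable: "f \<in> L2 M \<Longrightarrow> integrable M (\<lambda>x. (cmod (f x))\<^sup>2)"
  by (simp add: L2_def)

lemma l2norm_nonneg [simp]: "0 \<le> l2norm M f"
  by (simp add: l2norm_def)

lemma l2norm_power2: "(l2norm M f)\<^sup>2 = (LINT x|M. (cmod (f x))\<^sup>2)"
  by (simp add: l2norm_def)

lemma L2_mult_integrable:
  assumes f: "f \<in> L2 M" and g: "g \<in> L2 M"
  shows "integrable M (\<lambda>x. cmod (f x) * cmod (g x))"
proof (rule Bochner_Integration.integrable_bound)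
  show "integrable M (\<lambda>x. (cmod (f x))\<^sup>2 + (cmod (g x))\<^sup>2)"
    using f g by (intro Bochner_Integration.integrable_add L2_integrable)
  show "(\<lambda>x. cmod (f x) * cmod (g x)) \<in> borel_measurable M"
    using f g by measurable
  have "a * b \<le> a\<^sup>2 + b\<^sup>2" if "0 \<le> a" "0 \<le> b" for a b :: real
    using sum_squares_bound[of a b] mult_nonneg_nonneg[OF that] by linarith
  then show "AE x in M. norm (cmod (f x) * cmod (g x)) \<le> norm ((cmod (f x))\<^sup>2 + (cmod (g x))\<^sup>2)"
    by (simp add: abs_mult)
qed

lemma L2_inner_integrable:
  assumes "f \<in> L2 M" "g \<in> L2 M"
  shows "integrable M (\<lambda>x. f x * cnj (g x))"
  by (rule Bochner_Integration.integrable_bound[OF L2_mult_integrable[OF assms]])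
     (use assms in \<open>measurable, auto simp: norm_mult\<close>)

text \<open>Integrating the inequality 2 (s |f|) (t |g|) \<le> (s |f|)^2 + (t |g|)^2 gives a family
  of estimates \<open>I\<close> in the real parameters s and t. If both norms are positive, s =
  \<open>?b\<close> and t = \<open>?a\<close> make the two squares equal and the product of the
  norms cancels. If one norm vanishes, letting its parameter grow forces the integral to be
  0.\<close>

lemma L2_Cauchy_Schwarz:
  assumes f: "f \<in> L2 M" and g: "g \<in> L2 M"
  shows "(LINT x|M. cmod (f x) * cmod (g x)) \<le> l2norm M f * l2norm M g"
proof -
  let ?a = "l2norm M f" and ?b = "l2norm M g"
  let ?I = "LINT x|M. cmod (f x) * cmod (g x)"
  have I: "2 * s * t * ?I \<le> s\<^sup>2 * ?a\<^sup>2 + t\<^sup>2 * ?b\<^sup>2" for s t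
  proof -
    have "(LINT x|M. 2 * s * t * (cmod (f x) * cmod (g x)))
        \<le> (LINT x|M. s\<^sup>2 * (cmod (f x))\<^sup>2 + t\<^sup>2 * (cmod (g x))\<^sup>2)"
    proof (rule integral_mono)
      fix x
      show "2 * s * t * (cmod (f x) * cmod (g x)) \<le> s\<^sup>2 * (cmod (f x))\<^sup>2 + t\<^sup>2 * (cmod (g x))\<^sup>2"
        using sum_squares_bound[of "s * cmod (f x)" "t * cmod (g x)"]
        by (simp add: power_mult_distrib mult_ac)
    qed (use assms in \<open>auto intro!: integrable_mult_right L2_mult_integrable L2_integrable
          Bochner_Integration.integrable_add\<close>)
    also have "\<dots> = s\<^sup>2 * ?a\<^sup>2 + t\<^sup>2 * ?b\<^sup>2"
      using assms by (simp add: L2_integrable l2norm_power2)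
    finally show ?thesis by simp
  qed
  have absurd: False if "2 * (r + 1) \<le> r" "0 \<le> r" for r :: real
    using that by (simp add: distrib_left)
  have I0: "0 \<le> ?I" by (auto intro!: integral_nonneg_AE)
  show ?thesis
  proof (cases "?a = 0 \<or> ?b = 0")
    case True
    have "?I = 0"
    proof (rule ccontr)
      assume "?I \<noteq> 0"
      with I0 have pos: "?I > 0" by (simp only: order_less_le) simp
      from True show False
      proof
        assume a: "?a = 0"
        \<comment> \<open>For t = 1 and \<open>?a = 0\<close> the estimate reads 2 s
          \<open>?I\<close> \<le> \<open>?b\<close>^2. The chosen s turns the left side into 2
          (\<open>?b\<close>^2 + 1), which is too large; the other case is symmetric.\<close>
        have "2 * (?b\<^sup>2 + 1) \<le> ?b\<^sup>2"
          using I[of "(?b\<^sup>2 + 1) / ?I" 1] a pos by simp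
        then show False using absurd[of "?b\<^sup>2"] by simp
      next
        assume b: "?b = 0"
        have "2 * (?a\<^sup>2 + 1) \<le> ?a\<^sup>2"
          using I[of 1 "(?a\<^sup>2 + 1) / ?I"] b pos by simp
        then show False using absurd[of "?a\<^sup>2"] by simp
      qed
    qed
    then show ?thesis by simp
  next
    case False
    then have p: "0 < ?a" "0 < ?b"
      by (auto simp: order_less_le)
    have "2 * (?a * ?b) * ?I \<le> 2 * (?a * ?b) * (?a * ?b)"
      using I[of ?b ?a] by (simp add: power2_eq_square algebra_simps)
    then show ?thesis using p by simp
  qed
qed

lemma l2inner_bound:
  assumes "f \<in> L2 M" "g \<in> L2 M"
  shows "cmod (l2inner M f g) \<le> l2norm M f * l2norm M g"
proof -
  have "cmod (l2inner M f g) \<le> (LINT x|M. cmod (f x * cnj (g x)))"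
    unfolding l2inner_def by (rule integral_norm_bound)
  also have "\<dots> \<le> l2norm M f * l2norm M g"
    using L2_Cauchy_Schwarz[OF assms] by (simp add: norm_mult)
  finally show ?thesis .
qed

section \<open>Linear structure and triangle inequality for square-integrable functions\<close>

lemma L2_add:
  assumes f: "f \<in> L2 M" and g: "g \<in> L2 M"
  shows "(\<lambda>x. f x + g x) \<in> L2 M"
proof -
  have "integrable M (\<lambda>x. (cmod (f x + g x))\<^sup>2)"
  proof (rule Bochner_Integration.integrable_bound)
    show "integrable M (\<lambda>x. 2 * (cmod (f x))\<^sup>2 + 2 * (cmod (g x))\<^sup>2)"
      using f g by (auto intro!: Bochner_Integration.integrable_add integrable_mult_right L2_integrable)
    have "(cmod (a + b))\<^sup>2 \<le> 2 * (cmod a)\<^sup>2 + 2 * (cmod b)\<^sup>2" for a b :: complex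
    proof -
      have "(cmod (a + b))\<^sup>2 \<le> (cmod a + cmod b)\<^sup>2"
        by (intro power_mono norm_triangle_ineq) auto
      then show ?thesis
        using sum_squares_bound[of "cmod a" "cmod b"] by (simp add: power2_sum)
    qed
    then show "AE x in M. norm ((cmod (f x + g x))\<^sup>2) \<le> norm (2 * (cmod (f x))\<^sup>2 + 2 * (cmod (g x))\<^sup>2)"
      by simp
  qed (use f g in measurable)
  moreover have "(\<lambda>x. f x + g x) \<in> borel_measurable M"
    using f g by measurable
  ultimately show ?thesis by (simp add: L2_def)
qed

lemma L2_cmult:
  assumes "f \<in> L2 M"
  shows "(\<lambda>x. c * f x) \<in> L2 M"
  using assms by (auto simp: L2_def norm_mult power_mult_distrib)

lemma L2_diff:
  assumes "f \<in> L2 M" "g \<in> L2 M"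
  shows "(\<lambda>x. f x - g x) \<in> L2 M"
  using L2_add[OF assms(1) L2_cmult[OF assms(2), of "-1"]] by simp

lemma L2_zero [simp]: "(\<lambda>x. 0) \<in> L2 M"
  by (simp add: L2_def)

lemma l2norm_cmult: "l2norm M (\<lambda>x. c * f x) = cmod c * l2norm M f"
  by (simp add: l2norm_def norm_mult power_mult_distrib real_sqrt_mult)

lemma l2norm_minus_commute: "l2norm M (\<lambda>x. f x - g x) = l2norm M (\<lambda>x. g x - f x)"
  by (simp add: l2norm_def norm_minus_commute)

lemma l2norm_triangle:
  assumes f: "f \<in> L2 M" and g: "g \<in> L2 M"
  shows "l2norm M (\<lambda>x. f x + g x) \<le> l2norm M f + l2norm M g"
proof -
  have "(l2norm M (\<lambda>x. f x + g x))\<^sup>2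
      \<le> (LINT x|M. (cmod (f x))\<^sup>2 + 2 * (cmod (f x) * cmod (g x)) + (cmod (g x))\<^sup>2)"
    unfolding l2norm_power2
  proof (rule integral_mono)
    fix x
    have "(cmod (f x + g x))\<^sup>2 \<le> (cmod (f x) + cmod (g x))\<^sup>2"
      by (intro power_mono norm_triangle_ineq) auto
    then show "(cmod (f x + g x))\<^sup>2
        \<le> (cmod (f x))\<^sup>2 + 2 * (cmod (f x) * cmod (g x)) + (cmod (g x))\<^sup>2"
      by (simp add: power2_sum)
  qed (use f g in \<open>auto intro!: Bochner_Integration.integrable_add integrable_mult_right
        L2_integrable L2_mult_integrable L2_add\<close>)
  also have "\<dots> = (l2norm M f)\<^sup>2 + 2 * (LINT x|M. cmod (f x) * cmod (g x)) + (l2norm M g)\<^sup>2"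
    using f g by (simp add: L2_integrable L2_mult_integrable l2norm_power2)
  also have "\<dots> \<le> (l2norm M f + l2norm M g)\<^sup>2"
    using L2_Cauchy_Schwarz[OF f g] by (simp add: power2_sum)
  finally show ?thesis
    by (rule power2_le_imp_le) simp
qed

lemma l2norm_triangle_diff:
  assumes "f \<in> L2 M" "g \<in> L2 M" "h \<in> L2 M"
  shows "l2norm M (\<lambda>x. f x - h x) \<le> l2norm M (\<lambda>x. f x - g x) + l2norm M (\<lambda>x. g x - h x)"
  using l2norm_triangle[OF L2_diff[OF assms(1,2)] L2_diff[OF assms(2,3)]] by simp

lemma l2norm_eq_0_iff:
  assumes "f \<in> L2 M"
  shows "l2norm M f = 0 \<longleftrightarrow> (AE x in M. f x = 0)"
proof -
  have "l2norm M f = 0 \<longleftrightarrow> (LINT x|M. (cmod (f x))\<^sup>2) = 0"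
    by (simp add: l2norm_def)
  also have "\<dots> \<longleftrightarrow> (AE x in M. (cmod (f x))\<^sup>2 = 0)"
    using assms by (intro integral_nonneg_eq_0_iff_AE) (auto simp: L2_integrable)
  finally show ?thesis by simp
qed

lemma l2norm_diff_eq_0_iff:
  assumes "f \<in> L2 M" "g \<in> L2 M"
  shows "l2norm M (\<lambda>x. f x - g x) = 0 \<longleftrightarrow> (AE x in M. f x = g x)"
  using l2norm_eq_0_iff[OF L2_diff[OF assms]] by simp

lemma l2norm_zero [simp]: "l2norm M (\<lambda>x. 0) = 0"
  by (simp add: l2norm_def)

lemma l2norm_cong_AE:
  assumes "f \<in> L2 M" "g \<in> L2 M" "AE x in M. f x = g x"
  shows "l2norm M f = l2norm M g"
proof -
  have "(LINT x|M. (cmod (f x))\<^sup>2) = (LINT x|M. (cmod (g x))\<^sup>2)"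
    using assms by (intro integral_cong_AE) auto
  then show ?thesis by (simp add: l2norm_def)
qed

section \<open>Inner products and tests by duality\<close>

lemma l2inner_add_left:
  assumes "f \<in> L2 M" "g \<in> L2 M" "h \<in> L2 M"
  shows "l2inner M (\<lambda>x. f x + c * g x) h = l2inner M f h + c * l2inner M g h"
  using L2_inner_integrable[OF assms(1,3)] L2_inner_integrable[OF assms(2,3)]
  by (simp add: l2inner_def distrib_right mult.assoc)

lemma l2inner_diff_left:
  assumes "f \<in> L2 M" "g \<in> L2 M" "h \<in> L2 M"
  shows "l2inner M (\<lambda>x. f x - g x) h = l2inner M f h - l2inner M g h"
  using l2inner_add_left[OF assms, of "-1"] by simp

lemma l2inner_diff_right:
  assumes "f \<in> L2 M" "g \<in> L2 M" "h \<in> L2 M"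
  shows "l2inner M h (\<lambda>x. f x - g x) = l2inner M h f - l2inner M h g"
  using L2_inner_integrable[OF assms(3,1)] L2_inner_integrable[OF assms(3,2)]
  by (simp add: l2inner_def right_diff_distrib)

lemma l2inner_cong_AE:
  assumes "f \<in> L2 M" "f' \<in> L2 M" "g \<in> L2 M" "AE x in M. f x = f' x"
  shows "l2inner M f g = l2inner M f' g"
  unfolding l2inner_def using assms by (intro integral_cong_AE) (measurable, auto)

lemma l2inner_self: "l2inner M f f = of_real ((l2norm M f)\<^sup>2)"
proof -
  have "l2inner M f f = (LINT x|M. complex_of_real ((cmod (f x))\<^sup>2))"
    unfolding l2inner_def by (simp only: complex_norm_square)
  also have "\<dots> = of_real (LINT x|M. (cmod (f x))\<^sup>2)"
    by (rule integral_complex_of_real)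
  finally show ?thesis by (simp add: l2norm_power2)
qed

text \<open>Testing with g = f gives |f|^2 \<le> C |f| for the norm, and one factor cancels unless
  the norm is 0. This is how norm estimates for operators are obtained from estimates of their
  matrix coefficients.\<close>

lemma l2norm_le_of_inner_bound:
  assumes f: "f \<in> L2 M" and b: "\<And>g. g \<in> L2 M \<Longrightarrow> cmod (l2inner M f g) \<le> C * l2norm M g"
    and C: "0 \<le> C"
  shows "l2norm M f \<le> C"
proof (cases "l2norm M f = 0")
  case False
  then have p: "0 < l2norm M f" by (simp add: order_less_le)
  have "cmod (l2inner M f f) = (l2norm M f)\<^sup>2"
    by (simp only: l2inner_self norm_of_real abs_power2 real_norm_def abs_of_nonneg zero_le_power2)
  then have "l2norm M f * l2norm M f \<le> C * l2norm M f"
    using b[OF f] by (simp add: power2_eq_square)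
  then show ?thesis using p by simp
qed (use C in simp)

text \<open>The difference is orthogonal to everything, so the preceding bound applies with constant
  0. It serves for operators that are known only through their matrix coefficients.\<close>

lemma L2_AE_eqI:
  assumes f: "f \<in> L2 M" and g: "g \<in> L2 M"
    and eq: "\<And>h. h \<in> L2 M \<Longrightarrow> l2inner M f h = l2inner M g h"
  shows "AE x in M. f x = g x"
proof -
  have "l2norm M (\<lambda>x. f x - g x) \<le> 0"
    by (rule l2norm_le_of_inner_bound) (use f g in \<open>auto simp: L2_diff l2inner_diff_left eq\<close>)
  then have "l2norm M (\<lambda>x. f x - g x) = 0" using l2norm_nonneg by (intro antisym) auto
  then show ?thesis using f g by (simp add: l2norm_diff_eq_0_iff)
qed

text \<open>The geometric rate makes the sequence converge almost everywhere, since
  \<open>|F\<^sub>n\<^sub>+\<^sub>1 - F\<^sub>n| \<le> 2\<^sup>-\<^sup>n + 2\<^sup>n |F\<^sub>n\<^sub>+\<^sub>1 - F\<^sub>n|\<^sup>2\<close> and the right-hand side has an almost everywhere finite sum.\<close>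

lemma L2_complete:
  fixes F :: "nat \<Rightarrow> 'a \<Rightarrow> complex"
  assumes F: "\<And>n. F n \<in> L2 M" and c: "0 \<le> c"
    and le: "\<And>n m. n \<le> m \<Longrightarrow> l2norm M (\<lambda>x. F m x - F n x) \<le> c * (1/2) ^ n"
  shows "\<exists>G\<in>L2 M. \<forall>n. l2norm M (\<lambda>x. G x - F n x) \<le> c * (1/2) ^ n"
proof -
  define d where "d n x = F (Suc n) x - F n x" for n x
  have d: "d n \<in> L2 M" for n
    unfolding d_def by (intro L2_diff F)
  have [measurable]: "F n \<in> borel_measurable M" "d n \<in> borel_measurable M" for n
    using F d by measurable
  have nn: "(\<integral>\<^sup>+x. ennreal ((cmod (F m x - F n x))\<^sup>2) \<partial>M) \<le> ennreal ((c * (1/2) ^ n)\<^sup>2)"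
    if "n \<le> m" for m n
  proof -
    have "(\<integral>\<^sup>+x. ennreal ((cmod (F m x - F n x))\<^sup>2) \<partial>M) = ennreal ((l2norm M (\<lambda>x. F m x - F n x))\<^sup>2)"
      unfolding l2norm_power2
      by (intro nn_integral_eq_integral L2_integrable L2_diff F) simp
    also have "\<dots> \<le> ennreal ((c * (1/2) ^ n)\<^sup>2)"
      using le[OF that] by (intro ennreal_leI power_mono) auto
    finally show ?thesis .
  qed
  have "(\<integral>\<^sup>+x. (\<Sum>n. ennreal (2^n * (cmod (d n x))\<^sup>2)) \<partial>M) = (\<Sum>n. \<integral>\<^sup>+x. ennreal (2^n * (cmod (d n x))\<^sup>2) \<partial>M)"
    by (rule nn_integral_suminf) measurable
  \<comment> \<open>The squared rate contains 2^(-n) twice; the weight 2^n uses up one of the two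
    factors and a convergent geometric series remains.\<close>
  also have "\<dots> \<le> (\<Sum>n. ennreal (c\<^sup>2 * (1/2)^n))"
  proof (rule suminf_le)
    fix n
    have "(\<integral>\<^sup>+x. ennreal (2^n * (cmod (d n x))\<^sup>2) \<partial>M) = ennreal (2^n) * (\<integral>\<^sup>+x. ennreal ((cmod (d n x))\<^sup>2) \<partial>M)"
      by (subst nn_integral_cmult[symmetric]) (auto simp: ennreal_mult)
    also have "\<dots> \<le> ennreal (2^n) * ennreal ((c * (1/2) ^ n)\<^sup>2)"
      using nn[of n "Suc n"] unfolding d_def by (intro mult_left_mono) auto
    also have "\<dots> = ennreal (c\<^sup>2 * (1/2)^n)"
      by (subst ennreal_mult[symmetric]) (auto simp: power2_eq_square power_divide)
    finally show "(\<integral>\<^sup>+x. ennreal (2^n * (cmod (d n x))\<^sup>2) \<partial>M) \<le> ennreal (c\<^sup>2 * (1/2)^n)" .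
  qed auto
  also have "\<dots> < \<infinity>"
  proof -
    have "summable (\<lambda>n. c\<^sup>2 * (1/2)^n :: real)" by (intro summable_mult summable_geometric) simp
    then show ?thesis by (simp add: ennreal_suminf_neq_top less_top[symmetric])
  qed
  finally have fin: "(\<integral>\<^sup>+x. (\<Sum>n. ennreal (2^n * (cmod (d n x))\<^sup>2)) \<partial>M) \<noteq> \<infinity>" by simp
  have "AE x in M. (\<Sum>n. ennreal (2^n * (cmod (d n x))\<^sup>2)) \<noteq> \<infinity>"
    by (rule nn_integral_PInf_AE[OF _ fin]) measurable
  then have conv: "AE x in M. (\<lambda>n. F n x) \<longlonglongrightarrow> lim (\<lambda>n. F n x)"
  proof eventually_elim
    fix x assume *: "(\<Sum>n. ennreal (2^n * (cmod (d n x))\<^sup>2)) \<noteq> \<infinity>"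
    have s: "summable (\<lambda>n. 2^n * (cmod (d n x))\<^sup>2)"
      by (rule summable_suminf_not_top) (use * in auto)
    have "summable (\<lambda>n. d n x)"
    proof (rule summable_comparison_test)
      show "summable (\<lambda>n. (1/2)^n + 2^n * (cmod (d n x))\<^sup>2)"
        by (intro summable_add s summable_geometric) simp
      have "cmod (d n x) \<le> (1/2)^n + 2^n * (cmod (d n x))\<^sup>2" for n
      proof -
        \<comment> \<open>Expanding the square leaves 1 - 2^n |d| + 4^n |d|^2, and multiplication by
          2^(-n) gives the claimed inequality.\<close>
        have "0 \<le> (1 - 2^n * cmod (d n x))\<^sup>2 + 2^n * cmod (d n x)" by simp
        then have "0 \<le> (1/2)^n * ((1 - 2^n * cmod (d n x))\<^sup>2 + 2^n * cmod (d n x))" by simp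
        also have "\<dots> = (1/2)^n + 2^n * (cmod (d n x))\<^sup>2 - cmod (d n x)"
          by (simp add: power2_eq_square algebra_simps power_divide)
        finally show ?thesis by simp
      qed
      then show "\<exists>N. \<forall>n\<ge>N. norm (d n x) \<le> (1/2)^n + 2^n * (cmod (d n x))\<^sup>2" by auto
    qed
    then have "convergent (\<lambda>n. \<Sum>i<n. d i x)"
      by (simp add: summable_iff_convergent)
    moreover have "(\<Sum>i<n. d i x) = F n x - F 0 x" for n
      unfolding d_def by (rule sum_lessThan_telescope)
    ultimately have "convergent (\<lambda>n. F n x - F 0 x)" by simp
    then have "convergent (\<lambda>n. F n x)"
      by (simp add: convergent_diff_const_right_iff)
    then show "(\<lambda>n. F n x) \<longlonglongrightarrow> lim (\<lambda>n. F n x)"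
      by (simp add: convergent_LIMSEQ_iff)
  qed
  define G where "G x = lim (\<lambda>n. F n x)" for x
  have [measurable]: "G \<in> borel_measurable M"
    unfolding G_def by measurable
  \<comment> \<open>Fatou's lemma for m tending to infinity: \<open>G\<close> is almost everywhere
    the limit of \<open>F m\<close>, and the bound \<open>nn\<close> holds for all m \<ge>
    n.\<close>
  have nnG: "(\<integral>\<^sup>+x. ennreal ((cmod (G x - F n x))\<^sup>2) \<partial>M) \<le> ennreal ((c * (1/2) ^ n)\<^sup>2)" for n
  proof -
    have "(\<integral>\<^sup>+x. ennreal ((cmod (G x - F n x))\<^sup>2) \<partial>M)
        = (\<integral>\<^sup>+x. liminf (\<lambda>m. ennreal ((cmod (F m x - F n x))\<^sup>2)) \<partial>M)"
      using conv
    proof (intro nn_integral_cong_AE, eventually_elim)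
      fix x assume "(\<lambda>n. F n x) \<longlonglongrightarrow> lim (\<lambda>n. F n x)"
      then have "(\<lambda>m. ennreal ((cmod (F m x - F n x))\<^sup>2)) \<longlonglongrightarrow> ennreal ((cmod (G x - F n x))\<^sup>2)"
        unfolding G_def by (intro tendsto_ennrealI tendsto_intros)
      then show "ennreal ((cmod (G x - F n x))\<^sup>2) = liminf (\<lambda>m. ennreal ((cmod (F m x - F n x))\<^sup>2))"
        by (intro lim_imp_Liminf[symmetric]) auto
    qed
    also have "\<dots> \<le> liminf (\<lambda>m. \<integral>\<^sup>+x. ennreal ((cmod (F m x - F n x))\<^sup>2) \<partial>M)"
      by (rule nn_integral_liminf) measurable
    also have "\<dots> \<le> ennreal ((c * (1/2) ^ n)\<^sup>2)"
    proof -
      have "eventually (\<lambda>m. (\<integral>\<^sup>+x. ennreal ((cmod (F m x - F n x))\<^sup>2) \<partial>M) \<le> ennreal ((c * (1/2) ^ n)\<^sup>2)) sequentially"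
        using eventually_ge_at_top[of n] by eventually_elim (rule nn)
      then have "liminf (\<lambda>m. \<integral>\<^sup>+x. ennreal ((cmod (F m x - F n x))\<^sup>2) \<partial>M) \<le> liminf (\<lambda>m::nat. ennreal ((c * (1/2) ^ n)\<^sup>2))"
        by (rule Liminf_mono)
      then show ?thesis by (simp add: Liminf_const)
    qed
    finally show ?thesis .
  qed
  have GF: "(\<lambda>x. G x - F n x) \<in> L2 M" for n
    unfolding L2_def
    using le_less_trans[OF nnG[of n] ennreal_less_top]
    by (auto intro!: integrableI_bounded)
  have "l2norm M (\<lambda>x. G x - F n x) \<le> c * (1/2) ^ n" for n
  proof (rule power2_le_imp_le)
    have "ennreal ((l2norm M (\<lambda>x. G x - F n x))\<^sup>2) = (\<integral>\<^sup>+x. ennreal ((cmod (G x - F n x))\<^sup>2) \<partial>M)"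
      unfolding l2norm_power2
      by (rule nn_integral_eq_integral[symmetric]) (auto intro: L2_integrable GF)
    then show "(l2norm M (\<lambda>x. G x - F n x))\<^sup>2 \<le> (c * (1/2) ^ n)\<^sup>2"
      using nnG[of n] by (metis ennreal_le_iff zero_le_power2)
  qed (use c in simp)
  moreover have "G \<in> L2 M"
    using L2_add[OF GF[of 0] F[of 0]] by simp
  ultimately show ?thesis by blast
qed

section \<open>Bounded operators\<close>

lemma bdd_op_L2: "bdd_op M T \<Longrightarrow> f \<in> L2 M \<Longrightarrow> T f \<in> L2 M"
  by (simp add: bdd_op_def)

lemma bdd_op_cong: 
  "bdd_op M T \<Longrightarrow> f \<in> L2 M \<Longrightarrow> g \<in> L2 M \<Longrightarrow> AE x in M. f x = g x \<Longrightarrow> AE x in M. T f x = T g x"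
  by (simp add: bdd_op_def)

lemma bdd_op_linear:
  "bdd_op M T \<Longrightarrow> f \<in> L2 M \<Longrightarrow> g \<in> L2 M \<Longrightarrow> AE x in M. T (\<lambda>y. f y + c * g y) x = T f x + c * T g x"
  by (simp add: bdd_op_def)

lemma bdd_op_bound:
  assumes "bdd_op M T"
  obtains C where "0 \<le> C" "\<And>f. f \<in> L2 M \<Longrightarrow> l2norm M (T f) \<le> C * l2norm M f"
proof -
  obtain C where C: "\<And>f. f \<in> L2 M \<Longrightarrow> l2norm M (T f) \<le> C * l2norm M f"
    using assms unfolding bdd_op_def by blast
  \<comment> \<open>The constant in \<open>bdd_op\<close> carries no sign condition and may be
    negative if all norms vanish; the maximum with 0 makes it usable in monotonicity
    arguments.\<close>
  show thesis
  proof (rule that[of "max C 0"])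
    fix f assume "f \<in> L2 M"
    then show "l2norm M (T f) \<le> max C 0 * l2norm M f"
      using C[of f] mult_right_mono[of C "max C 0" "l2norm M f"] by simp
  qed simp
qed

lemma bdd_op_inner_diff:
  assumes T: "bdd_op M T" and f: "f \<in> L2 M" and f': "f' \<in> L2 M" and g: "g \<in> L2 M"
  shows "l2inner M (T (\<lambda>x. f x - f' x)) g = l2inner M (T f) g - l2inner M (T f') g"
proof -
  have "l2inner M (T (\<lambda>x. f x + (-1) * f' x)) g = l2inner M (\<lambda>x. T f x + (-1) * T f' x) g"
    by (intro l2inner_cong_AE bdd_op_linear[OF T f f'] bdd_op_L2[OF T] L2_add L2_cmult f f' g)
  also have "\<dots> = l2inner M (T f) g + (-1) * l2inner M (T f') g"
    by (intro l2inner_add_left bdd_op_L2[OF T] f f' g)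
  finally show ?thesis by simp
qed

text \<open>A bound for the operator makes the set in \<open>op_norm\<close> bounded above, so its
  supremum is meaningful. A function of positive norm is scaled to norm 1; a function of norm 0 is
  mapped to one of norm 0.\<close>

lemma l2norm_le_op_norm:
  assumes T: "bdd_op M T" and f: "f \<in> L2 M"
  shows "l2norm M (T f) \<le> op_norm M T * l2norm M f"
proof -
  obtain C where C: "0 \<le> C" "\<And>f. f \<in> L2 M \<Longrightarrow> l2norm M (T f) \<le> C * l2norm M f"
    by (rule bdd_op_bound[OF T]) blast
  let ?S = "{l2norm M (T f) | f. f \<in> L2 M \<and> l2norm M f \<le> 1}"
  have bdd: "bdd_above ?S"
  proof (rule bdd_aboveI)
    fix s assume "s \<in> ?S"
    then obtain f where f: "f \<in> L2 M" "l2norm M f \<le> 1" "s = l2norm M (T f)" by auto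
    then show "s \<le> C" using C(2)[of f] mult_left_mono[of "l2norm M f" 1 C] C(1) by simp
  qed
  have T0: "l2norm M (T (\<lambda>_. 0)) = 0"
    using C(2)[of "\<lambda>_. 0"] l2norm_nonneg[of M "T (\<lambda>_. 0)"] by simp
  show ?thesis
  proof (cases "l2norm M f = 0")
    case True
    then show ?thesis using C(2)[OF f] by simp
  next
    case False
    then have p: "0 < l2norm M f" by (simp add: order_less_le)
    define c where "c = complex_of_real (1 / l2norm M f)"
    have cn: "cmod c = 1 / l2norm M f" using p by (simp add: c_def norm_divide)
    have cf: "(\<lambda>x. c * f x) \<in> L2 M" by (rule L2_cmult[OF f])
    \<comment> \<open>\<open>bdd_op\<close> states linearity only in the form f + c g, almost
      everywhere. Homogeneity is the case f = 0, combined with the vanishing of T 0 almost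
      everywhere.\<close>
    have "AE x in M. T (\<lambda>y. 0 + c * f y) x = T (\<lambda>_. 0) x + c * T f x"
      using bdd_op_linear[OF T L2_zero f] .
    moreover have "AE x in M. T (\<lambda>_. 0) x = 0"
      using T0 by (subst (asm) l2norm_eq_0_iff) (auto intro: bdd_op_L2[OF T])
    ultimately have "AE x in M. T (\<lambda>y. c * f y) x = c * T f x"
      by eventually_elim simp
    then have "l2norm M (T (\<lambda>y. c * f y)) = cmod c * l2norm M (T f)"
      by (subst l2norm_cmult[symmetric], intro l2norm_cong_AE) (auto intro: bdd_op_L2[OF T] cf L2_cmult f)
    moreover have "l2norm M (T (\<lambda>y. c * f y)) \<le> op_norm M T"
      unfolding op_norm_def
      by (rule cSup_upper[OF _ bdd]) (use cf p in \<open>auto simp: l2norm_cmult cn\<close>)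
    ultimately have "1 / l2norm M f * l2norm M (T f) \<le> op_norm M T" by (simp add: cn)
    then show ?thesis using p by (simp add: pos_divide_le_eq)
  qed
qed

lemma op_norm_leI:
  assumes "0 \<le> C" "\<And>f. f \<in> L2 M \<Longrightarrow> l2norm M (T f) \<le> C * l2norm M f"
  shows "op_norm M T \<le> C"
  unfolding op_norm_def
proof (rule cSup_least)
  show "{l2norm M (T f) | f. f \<in> L2 M \<and> l2norm M f \<le> 1} \<noteq> {}"
    by (auto intro!: exI[of _ "\<lambda>_. 0"])
  fix s assume "s \<in> {l2norm M (T f) | f. f \<in> L2 M \<and> l2norm M f \<le> 1}"
  then obtain f where f: "f \<in> L2 M" "l2norm M f \<le> 1" "s = l2norm M (T f)" by auto
  then show "s \<le> C" using assms(2)[of f] mult_left_mono[of "l2norm M f" 1 C] assms(1) by simp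
qed

lemma bdd_op_diff:
  assumes T: "bdd_op M T" and S: "bdd_op M S"
  shows "bdd_op M (\<lambda>f y. T f y - S f y)"
  unfolding bdd_op_def
proof (intro conjI ballI allI impI)
  fix f assume f: "f \<in> L2 M"
  show "(\<lambda>y. T f y - S f y) \<in> L2 M"
    by (intro L2_diff bdd_op_L2[OF T] bdd_op_L2[OF S] f)
  fix g assume g: "g \<in> L2 M"
  show "AE x in M. T f x - S f x = T g x - S g x" if eq: "AE x in M. f x = g x"
    using bdd_op_cong[OF T f g eq] bdd_op_cong[OF S f g eq] by eventually_elim simp
  show "AE x in M. T (\<lambda>y. f y + c * g y) x - S (\<lambda>y. f y + c * g y) x =
            T f x - S f x + c * (T g x - S g x)" for c
    using bdd_op_linear[OF T f g, of c] bdd_op_linear[OF S f g, of c]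
    by eventually_elim (simp add: algebra_simps)
next
  obtain C where C: "0 \<le> C" "\<And>f. f \<in> L2 M \<Longrightarrow> l2norm M (T f) \<le> C * l2norm M f"
    by (rule bdd_op_bound[OF T]) blast
  obtain D where D: "0 \<le> D" "\<And>f. f \<in> L2 M \<Longrightarrow> l2norm M (S f) \<le> D * l2norm M f"
    by (rule bdd_op_bound[OF S]) blast
  show "\<exists>C. \<forall>f\<in>L2 M. l2norm M (\<lambda>y. T f y - S f y) \<le> C * l2norm M f"
  proof (intro exI ballI)
    fix f assume f: "f \<in> L2 M"
    have "l2norm M (\<lambda>y. T f y - S f y) \<le> l2norm M (T f) + l2norm M (S f)"
      using l2norm_triangle_diff[OF bdd_op_L2[OF T f] L2_zero bdd_op_L2[OF S f]]
      by (simp add: l2norm_def)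
    also have "\<dots> \<le> (C + D) * l2norm M f"
      using C(2)[OF f] D(2)[OF f] by (simp add: distrib_right)
    finally show "l2norm M (\<lambda>y. T f y - S f y) \<le> (C + D) * l2norm M f" .
  qed
qed

text \<open>The distance of the two limits is at most (a + b) 2^(-n) for every n. This is used to
  show that an operator defined by choosing limits respects almost everywhere equality and linear
  combinations.\<close>

lemma L2_limit_unique:
  fixes F :: "nat \<Rightarrow> 'a \<Rightarrow> complex"
  assumes X: "X \<in> L2 M" and Y: "Y \<in> L2 M" and F: "\<And>n. F n \<in> L2 M"
    and a: "\<And>n. l2norm M (\<lambda>x. X x - F n x) \<le> a * (1/2)^n"
    and b: "\<And>n. l2norm M (\<lambda>x. Y x - F n x) \<le> b * (1/2)^n"
  shows "AE x in M. X x = Y x"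
proof -
  have "l2norm M (\<lambda>x. X x - Y x) \<le> (a + b) * (1/2)^n" for n
    using l2norm_triangle_diff[OF X F Y, of n] a[of n] b[of n]
    by (simp add: l2norm_minus_commute[of M "F n" Y] distrib_right)
  moreover have "(\<lambda>n. (a + b) * (1/2)^n) \<longlonglongrightarrow> (a + b) * 0"
    by (intro tendsto_mult tendsto_const LIMSEQ_power_zero) simp
  ultimately have "l2norm M (\<lambda>x. X x - Y x) \<le> (a + b) * 0"
    by (intro LIMSEQ_le_const) auto
  then have "l2norm M (\<lambda>x. X x - Y x) = 0"
    using l2norm_nonneg[of M "\<lambda>x. X x - Y x"] by simp
  then show ?thesis using X Y by (simp add: l2norm_diff_eq_0_iff)
qed

text \<open>For each f the sequence \<open>A n f\<close> has a limit by completeness, and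
  \<open>S f\<close> is a choice of one. Choices for different f are unrelated, so congruence and
  linearity are recovered from uniqueness of limits: both sides of each identity are limits of the
  same sequence.\<close>

lemma bdd_op_limit:
  fixes A :: "nat \<Rightarrow> ('a \<Rightarrow> complex) \<Rightarrow> 'a \<Rightarrow> complex"
  assumes A: "\<And>n. bdd_op M (A n)" and c: "0 \<le> c"
    and le: "\<And>n m f. n \<le> m \<Longrightarrow> f \<in> L2 M \<Longrightarrow>
      l2norm M (\<lambda>x. A m f x - A n f x) \<le> c * (1/2)^n * l2norm M f"
  obtains S where "bdd_op M S"
    "\<And>n f. f \<in> L2 M \<Longrightarrow> l2norm M (\<lambda>x. S f x - A n f x) \<le> c * (1/2)^n * l2norm M f"
proof -
  note AL = bdd_op_L2[OF A]
  have "\<exists>G\<in>L2 M. \<forall>n. l2norm M (\<lambda>x. G x - A n f x) \<le> (c * l2norm M f) * (1/2)^n"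
    if f: "f \<in> L2 M" for f
  proof (rule L2_complete)
    show "l2norm M (\<lambda>x. A m f x - A n f x) \<le> (c * l2norm M f) * (1/2)^n" if "n \<le> m" for n m
      using le[OF that f] by (simp only: mult_ac)
  qed (use c in \<open>simp_all add: AL[OF f]\<close>)
  then obtain S where S: "\<And>f. f \<in> L2 M \<Longrightarrow> S f \<in> L2 M"
    and Sn: "\<And>f n. f \<in> L2 M \<Longrightarrow> l2norm M (\<lambda>x. S f x - A n f x) \<le> (c * l2norm M f) * (1/2)^n"
    by metis
  have "bdd_op M S"
    unfolding bdd_op_def
  proof (intro conjI ballI allI impI)
    fix f assume f: "f \<in> L2 M"
    then show "S f \<in> L2 M" by (rule S)
    fix g assume g: "g \<in> L2 M"
    show "AE x in M. S f x = S g x" if eq: "AE x in M. f x = g x"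
    proof (rule L2_limit_unique[OF S[OF f] S[OF g], of "\<lambda>n. A n f"])
      fix n
      have "l2norm M (\<lambda>x. S g x - A n f x) = l2norm M (\<lambda>x. S g x - A n g x)"
        using bdd_op_cong[OF A f g eq, of n]
        by (intro l2norm_cong_AE L2_diff S AL f g) auto
      then show "l2norm M (\<lambda>x. S g x - A n f x) \<le> (c * l2norm M g) * (1/2)^n"
        using Sn[OF g] by simp
    qed (rule AL[OF f] Sn[OF f])+
    fix d :: complex
    have fg: "(\<lambda>y. f y + d * g y) \<in> L2 M" by (intro L2_add L2_cmult f g)
    show "AE x in M. S (\<lambda>y. f y + d * g y) x = S f x + d * S g x"
    proof (rule L2_limit_unique[OF S[OF fg] L2_add[OF S[OF f] L2_cmult[OF S[OF g]]],
        of "\<lambda>n. A n (\<lambda>y. f y + d * g y)"])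
      fix n
      have "l2norm M (\<lambda>x. S f x + d * S g x - A n (\<lambda>y. f y + d * g y) x)
          = l2norm M (\<lambda>x. (S f x - A n f x) + d * (S g x - A n g x))"
        using bdd_op_linear[OF A f g, of n d]
        by (intro l2norm_cong_AE L2_diff L2_add L2_cmult S AL f g) (auto simp: algebra_simps)
      also have "\<dots> \<le> l2norm M (\<lambda>x. S f x - A n f x) + cmod d * l2norm M (\<lambda>x. S g x - A n g x)"
        unfolding l2norm_cmult[symmetric]
        by (intro l2norm_triangle L2_diff L2_cmult S AL f g)
      also have "\<dots> \<le> (c * l2norm M f) * (1/2)^n + cmod d * ((c * l2norm M g) * (1/2)^n)"
        by (intro add_mono mult_left_mono Sn f g) auto
      finally show "l2norm M (\<lambda>x. S f x + d * S g x - A n (\<lambda>y. f y + d * g y) x)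
          \<le> (c * l2norm M f + cmod d * (c * l2norm M g)) * (1/2)^n"
        by (simp add: algebra_simps)
    qed (rule AL[OF fg] Sn[OF fg])+
  next
    obtain C where C: "0 \<le> C" "\<And>f. f \<in> L2 M \<Longrightarrow> l2norm M (A 0 f) \<le> C * l2norm M f"
      by (rule bdd_op_bound[OF A]) blast
    \<comment> \<open>The estimate for n = 0 suffices, from S f = (S f - A 0 f) + A 0 f.\<close>
    have "l2norm M (S f) \<le> (c + C) * l2norm M f" if f: "f \<in> L2 M" for f
      using l2norm_triangle[OF L2_diff[OF S[OF f] AL[OF f, of 0]] AL[OF f, of 0]] Sn[OF f, of 0] C(2)[OF f]
      by (simp add: distrib_right)
    then show "\<exists>C. \<forall>f\<in>L2 M. l2norm M (S f) \<le> C * l2norm M f" by blast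
  qed
  then show thesis
  proof (rule that)
    show "l2norm M (\<lambda>x. S f x - A n f x) \<le> c * (1/2)^n * l2norm M f" if "f \<in> L2 M" for n f
      using Sn[OF that, of n] by (simp only: mult_ac)
  qed
qed

section \<open>Integrals as finite combinations of point evaluations\<close>

text \<open>A list of weighted points stands for a finitely supported complex measure. Points may
  repeat, so that concatenation is addition of measures.\<close>

definition point_eval :: "(complex \<times> 'a) list \<Rightarrow> ('a \<Rightarrow> complex) \<Rightarrow> complex" where
  "point_eval xs f = (\<Sum>(c,x)\<leftarrow>xs. c * f x)"

lemma point_eval_append: "point_eval (xs @ ys) f = point_eval xs f + point_eval ys f"
  by (simp add: point_eval_def)

lemma point_eval_scale: "point_eval (map (\<lambda>(c,x). (a * c, x)) xs) f = a * point_eval xs f"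
  by (induction xs) (auto simp: point_eval_def algebra_simps)

lemma point_eval_diff: "point_eval xs (\<lambda>x. f x - a * g x) = point_eval xs f - a * point_eval xs g"
  by (induction xs) (auto simp: point_eval_def algebra_simps)

lemma point_eval_sum:
  "point_eval xs (\<lambda>x. \<Sum>i<n. a i * v i x) = (\<Sum>i<n. a i * point_eval xs (v i))"
  by (induction xs) (auto simp: point_eval_def algebra_simps sum.distrib sum_distrib_left)

text \<open>Duality in finite dimension: a function outside the span of the \<open>v i\<close> is
  separated from the span by a finite combination of point evaluations. In the induction
  \<open>v n\<close> is either redundant or comes with a combination \<open>p\<close> that kills the
  earlier functions and takes the value 1 at \<open>v n\<close>.\<close>

lemma point_evaluations_dichotomy:
  fixes v :: "nat \<Rightarrow> 'a \<Rightarrow> complex"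
  shows "(\<exists>\<alpha>. \<forall>x. w x = (\<Sum>i<n. \<alpha> i * v i x)) \<or>
    (\<exists>xs. (\<forall>i<n. point_eval xs (v i) = 0) \<and> point_eval xs w = 1)"
proof (induction n arbitrary: w)
  case 0
  show ?case
  proof (cases "\<forall>x. w x = 0")
    case False
    then obtain x where "w x \<noteq> 0" by blast
    then have "point_eval [(1 / w x, x)] w = 1" by (simp add: point_eval_def)
    then show ?thesis by blast
  qed auto
next
  case (Suc n)
  consider (dep) \<alpha> where "\<And>x. v n x = (\<Sum>i<n. \<alpha> i * v i x)"
    | (sep) p where "\<And>i. i < n \<Longrightarrow> point_eval p (v i) = 0" "point_eval p (v n) = 1"
    using Suc.IH[of "v n"] by blast
  then have "(\<exists>\<alpha>. \<forall>x. w x = (\<Sum>i<Suc n. \<alpha> i * v i x)) \<or>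
      (\<exists>xs. (\<forall>i<Suc n. point_eval xs (v i) = 0) \<and> point_eval xs w = 1)"
  proof cases
    case dep
    then have vn: "v n = (\<lambda>x. \<Sum>i<n. \<alpha> i * v i x)" by auto
    from Suc.IH[of w] show ?thesis
    proof
      assume "\<exists>\<beta>. \<forall>x. w x = (\<Sum>i<n. \<beta> i * v i x)"
      then obtain \<beta> where "\<And>x. w x = (\<Sum>i<n. \<beta> i * v i x)" by blast
      then have "\<forall>x. w x = (\<Sum>i<Suc n. (\<beta>(n := 0)) i * v i x)" by simp
      then show ?thesis by (intro disjI1) (rule exI)
    next
      assume "\<exists>xs. (\<forall>i<n. point_eval xs (v i) = 0) \<and> point_eval xs w = 1"
      then obtain xs where xs: "\<forall>i<n. point_eval xs (v i) = 0" "point_eval xs w = 1" by blast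
      have "point_eval xs (v n) = 0" by (subst vn, subst point_eval_sum) (use xs in simp)
      with xs show ?thesis by (auto simp: less_Suc_eq)
    qed
  next
    case sep
    \<comment> \<open>Subtracting \<open>point_eval p w\<close> times \<open>v n\<close> from
      \<open>w\<close> produces a function on which \<open>p\<close> vanishes, so that the
      \<open>v n\<close> component is split off.\<close>
    from Suc.IH[of "\<lambda>x. w x - point_eval p w * v n x"] show ?thesis
    proof
      assume "\<exists>\<beta>. \<forall>x. w x - point_eval p w * v n x = (\<Sum>i<n. \<beta> i * v i x)"
      then obtain \<beta> where \<beta>: "\<And>x. w x - point_eval p w * v n x = (\<Sum>i<n. \<beta> i * v i x)" by blast
      have "\<forall>x. w x = (\<Sum>i<Suc n. (\<beta>(n := point_eval p w)) i * v i x)"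
        using \<beta> by (simp add: diff_eq_eq)
      then show ?thesis by (intro disjI1) (rule exI)
    next
      assume "\<exists>xs. (\<forall>i<n. point_eval xs (v i) = 0) \<and> point_eval xs (\<lambda>x. w x - point_eval p w * v n x) = 1"
      then obtain q where q: "\<forall>i<n. point_eval q (v i) = 0" "point_eval q (\<lambda>x. w x - point_eval p w * v n x) = 1"
        by blast
      \<comment> \<open>The combination q - q(v n) p still kills the earlier functions, now also
        kills \<open>v n\<close>, and takes on \<open>w\<close> the value that \<open>q\<close>
        takes on the corrected function, namely 1.\<close>
      define r where "r = q @ map (\<lambda>(c,x). (- point_eval q (v n) * c, x)) p"
      have r: "point_eval r f = point_eval q f - point_eval q (v n) * point_eval p f" for f
        unfolding r_def point_eval_append point_eval_scale by simp
      have "point_eval r (v i) = 0" if "i < Suc n" for i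
        using that q(1) sep by (cases "i = n") (simp_all add: r)
      moreover have "point_eval r w = 1"
        using q(2) unfolding r point_eval_diff by (simp add: mult.commute)
      ultimately show ?thesis by blast
    qed
  qed
  then show ?case .
qed

text \<open>On finitely many functions an integral agrees exactly with a finite combination of point
  evaluations. If \<open>v n\<close> depends linearly on the earlier functions, the previous
  combination is already correct; otherwise a separating combination \<open>p\<close> corrects the
  value at \<open>v n\<close> by its defect \<open>a\<close> and leaves the other values
  alone.\<close>

lemma integral_eq_point_evaluations:
  fixes v :: "nat \<Rightarrow> 'a \<Rightarrow> complex"
  assumes "\<And>i. i < n \<Longrightarrow> integrable M (\<lambda>x. h x * v i x)"
  shows "\<exists>xs. \<forall>i<n. (LINT x|M. h x * v i x) = point_eval xs (v i)"
  using assms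
proof (induction n)
  case (Suc n)
  from Suc.IH Suc.prems have "\<exists>xs. \<forall>i<n. (LINT x|M. h x * v i x) = point_eval xs (v i)"
    by simp
  then obtain xs where xs: "\<And>i. i < n \<Longrightarrow> (LINT x|M. h x * v i x) = point_eval xs (v i)"
    by blast
  from point_evaluations_dichotomy[where w = "v n" and n = n and v = v] show ?case
  proof
    assume "\<exists>\<alpha>. \<forall>x. v n x = (\<Sum>i<n. \<alpha> i * v i x)"
    then obtain \<alpha> where dep: "\<forall>x. v n x = (\<Sum>i<n. \<alpha> i * v i x)" ..
    then have vn: "v n = (\<lambda>x. \<Sum>i<n. \<alpha> i * v i x)" unfolding fun_eq_iff .
    have "(LINT x|M. h x * v n x) = (LINT x|M. (\<Sum>i<n. \<alpha> i * (h x * v i x)))"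
      by (subst vn) (simp add: sum_distrib_left mult_ac)
    also have "\<dots> = (\<Sum>i<n. \<alpha> i * (LINT x|M. h x * v i x))"
      using Suc.prems by (subst Bochner_Integration.integral_sum) auto
    also have "\<dots> = point_eval xs (v n)"
      by (subst vn, subst point_eval_sum) (simp add: xs)
    finally show ?case using xs by (intro exI[of _ xs]) (auto simp: less_Suc_eq)
  next
    assume "\<exists>p. (\<forall>i<n. point_eval p (v i) = 0) \<and> point_eval p (v n) = 1"
    then obtain p where sep: "\<forall>i<n. point_eval p (v i) = 0" "point_eval p (v n) = 1" by blast
    define a where "a = (LINT x|M. h x * v n x) - point_eval xs (v n)"
    have "(LINT x|M. h x * v i x) = point_eval (xs @ map (\<lambda>(c,x). (a * c, x)) p) (v i)" if "i < Suc n" for i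
      using that sep xs by (cases "i = n") (simp_all add: point_eval_append point_eval_scale a_def)
    then show ?case by blast
  qed
qed simp

section \<open>Haar measure and convolution operators\<close>

lemma borel_measurable_uminus_group [measurable (raw)]:
  fixes f :: "'b \<Rightarrow> 'a::{topological_group_add, t2_space, second_countable_topology}"
  assumes "f \<in> borel_measurable N"
  shows "(\<lambda>x. - f x) \<in> borel_measurable N"
  using assms
  by (rule measurable_compose[OF _ borel_measurable_continuous_onI])
     (intro continuous_on_minus continuous_on_id)

locale haar_group =
  fixes M :: "'a::{topological_group_add, t2_space, second_countable_topology} measure"
  assumes haar: "haar_measure M" and locally_compact: "lcsc_group TYPE('a)"
begin

lemma sets_eq_borel [measurable_cong]: "sets M = sets borel"
  using haar by (simp add: haar_measure_def)

lemma space_eq_UNIV [simp]: "space M = UNIV"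
  using sets_eq_imp_space_eq[OF sets_eq_borel] by simp

lemma measurable_borel: "f \<in> borel_measurable M \<Longrightarrow> f \<in> borel_measurable borel"
  using measurable_cong_sets[OF sets_eq_borel refl] by blast

lemma L2_borel: "f \<in> L2 M \<Longrightarrow> f \<in> borel_measurable borel"
  by (intro measurable_borel L2_measurable)

lemma compact_in_sets: "compact K \<Longrightarrow> K \<in> sets M"
  by (simp add: sets_eq_borel borel_closed compact_imp_closed)

lemma emeasure_compact: "compact K \<Longrightarrow> emeasure M K < \<infinity>"
  using haar by (simp add: haar_measure_def)

section \<open>Exhaustion by compact sets and sigma-finiteness\<close>

lemma compact_neighbourhood:
  obtains U K :: "'a set" where "open U" "compact K" "x \<in> U" "U \<subseteq> K"
proof -
  have "\<exists>U K. open U \<and> compact K \<and> x \<in> U \<and> U \<subseteq> K"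
    using locally_compact unfolding lcsc_group_def locally_compact_space_def by simp
  then show thesis using that by blast
qed

text \<open>The open sets contained in some compact set cover the group by local compactness, and
  countably many of them suffice by the Lindelof property. Finite unions of the first enclosing
  compact sets form the increasing sequence.\<close>

lemma compact_exhaustion:
  obtains K :: "nat \<Rightarrow> 'a set" where "\<And>n. compact (K n)" "incseq K" "(\<Union>n. K n) = UNIV"
proof -
  define \<F> where "\<F> = {U :: 'a set. open U \<and> (\<exists>K. compact K \<and> U \<subseteq> K)}"
  have "\<Union>\<F> = UNIV"
  proof (rule UNIV_eq_I[symmetric])
    fix x
    obtain U K :: "'a set" where "open U" "compact K" "x \<in> U" "U \<subseteq> K"
      by (rule compact_neighbourhood)
    then show "x \<in> \<Union>\<F>" unfolding \<F>_def by blast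
  qed
  moreover obtain \<F>' where F': "\<F>' \<subseteq> \<F>" "countable \<F>'" "\<Union>\<F>' = \<Union>\<F>"
    by (rule Lindelof[of \<F>]) (auto simp: \<F>_def)
  ultimately have U: "\<Union>\<F>' = UNIV" by simp
  then have ne: "\<F>' \<noteq> {}" by auto
  have "\<forall>U\<in>\<F>'. \<exists>K. compact K \<and> U \<subseteq> K"
    using F'(1) by (auto simp: \<F>_def)
  then obtain D where D: "\<And>U. U \<in> \<F>' \<Longrightarrow> compact (D U) \<and> U \<subseteq> D U"
    by metis
  define K where "K n = (\<Union>i\<le>n. D (from_nat_into \<F>' i))" for n
  show thesis
  proof (rule that)
    show "compact (K n)" for n
      unfolding K_def using D from_nat_into[OF ne] by (intro compact_UN) auto
    show "incseq K"
      unfolding K_def incseq_def by force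
    show "(\<Union>n. K n) = UNIV"
    proof (rule UNIV_eq_I[symmetric])
      fix x
      have "x \<in> \<Union>\<F>'" unfolding U by simp
      then obtain U where U: "x \<in> U" "U \<in> \<F>'" by blast
      obtain i where "from_nat_into \<F>' i = U"
        using from_nat_into_surj[OF F'(2) U(2)] by blast
      then have "x \<in> K i" unfolding K_def using D[OF U(2)] U(1) by blast
      then show "x \<in> (\<Union>n. K n)" by blast
    qed
  qed
qed

text \<open>Sigma-finiteness opens the way to Fubini's theorem on products and to Radon-Nikodym
  derivatives.\<close>

sublocale sigma_finite_measure M
proof
  obtain K :: "nat \<Rightarrow> 'a set" where K: "\<And>n. compact (K n)" "incseq K" "(\<Union>n. K n) = UNIV"
    by (rule compact_exhaustion) blast
  have "emeasure M a \<noteq> \<infinity>" if "a \<in> range K" for a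
    using that emeasure_compact[OF K(1)] by (auto simp: order_less_le)
  then show "\<exists>A. countable A \<and> A \<subseteq> sets M \<and> \<Union>A = space M \<and> (\<forall>a\<in>A. emeasure M a \<noteq> \<infinity>)"
    using K by (intro exI[of _ "range K"]) (auto simp: compact_in_sets)
qed

sublocale pair: pair_sigma_finite M M ..

text \<open>The preimage of A under translation by x is the image of A under translation by -x, so
  the invariance in \<open>haar_measure\<close>, which speaks of images, yields invariance of the
  push-forward.\<close>

lemma distr_left_transl: "distr M M (\<lambda>y. x + y) = M"
proof (rule measure_eqI)
  have m: "(\<lambda>y. x + y) \<in> measurable M M" by measurable
  fix A assume A: "A \<in> sets (distr M M (\<lambda>y. x + y))"
  have "(\<lambda>y. x + y) -` A = (\<lambda>y. - x + y) ` A"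
    by (force simp: image_iff add.assoc[symmetric])
  then show "emeasure (distr M M (\<lambda>y. x + y)) A = emeasure M A"
    using A m haar by (simp add: emeasure_distr haar_measure_def sets_eq_borel)
qed simp

lemma integral_left_transl:
  fixes f :: "'a \<Rightarrow> 'b::{banach, second_countable_topology}"
  assumes [measurable]: "f \<in> borel_measurable M"
  shows "(LINT y|M. f (x + y)) = (LINT y|M. f y)"
proof -
  have "(LINT y|M. f (x + y)) = integral\<^sup>L (distr M M (\<lambda>y. x + y)) f"
    by (rule integral_distr[symmetric]) measurable
  then show ?thesis by (simp only: distr_left_transl)
qed

lemma integrable_left_transl:
  fixes f :: "'a \<Rightarrow> 'b::{banach, second_countable_topology}"
  assumes "integrable M f"
  shows "integrable M (\<lambda>y. f (x + y))"
proof -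
  have "integrable (distr M M (\<lambda>y. x + y)) f" using assms by (simp only: distr_left_transl)
  then show ?thesis by (rule integrable_distr[rotated]) measurable
qed

section \<open>Translations and coefficient functions\<close>

lemma L2_transl:
  assumes f: "f \<in> L2 M"
  shows "(\<lambda>y. f (x + y)) \<in> L2 M"
proof -
  note [measurable] = L2_borel[OF f]
  have "(\<lambda>y. f (x + y)) \<in> borel_measurable M" by measurable
  then show ?thesis
    using integrable_left_transl[OF L2_integrable[OF f]] by (simp add: L2_def)
qed

lemma l2norm_transl:
  assumes "f \<in> L2 M"
  shows "l2norm M (\<lambda>y. f (x + y)) = l2norm M f"
  unfolding l2norm_def
  using integral_left_transl[OF borel_measurable_integrable[OF L2_integrable[OF assms]], of x] by simp

lemma L2_left_transl: "f \<in> L2 M \<Longrightarrow> left_transl x f \<in> L2 M"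
  unfolding left_transl_def by (rule L2_transl)

lemma l2norm_left_transl: "f \<in> L2 M \<Longrightarrow> l2norm M (left_transl x f) = l2norm M f"
  unfolding left_transl_def by (rule l2norm_transl)

lemma coef_bound:
  assumes "f \<in> L2 M" "g \<in> L2 M"
  shows "cmod (coef M f g x) \<le> l2norm M f * l2norm M g"
  unfolding coef_def
  using l2inner_bound[OF L2_left_transl[OF assms(1), of x] assms(2)] assms
  by (simp add: l2norm_left_transl)

lemma coef_measurable:
  assumes f: "f \<in> L2 M" and g: "g \<in> L2 M"
  shows "coef M f g \<in> borel_measurable M"
proof -
  note [measurable] = L2_borel[OF f] L2_borel[OF g]
  show ?thesis
    unfolding coef_def l2inner_def left_transl_def by measurable
qed

lemma integrable_mult_bounded:
  fixes k w :: "'a \<Rightarrow> complex"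
  assumes k: "integrable M k" and w: "w \<in> borel_measurable M" "\<And>x. cmod (w x) \<le> B"
  shows "integrable M (\<lambda>x. k x * w x)"
proof (rule Bochner_Integration.integrable_bound)
  show "integrable M (\<lambda>x. B * cmod (k x))" using k by simp
  show "(\<lambda>x. k x * w x) \<in> borel_measurable M" using k w by measurable
  have "0 \<le> B" using order_trans[OF norm_ge_zero w(2)] .
  then show "AE x in M. norm (k x * w x) \<le> norm (B * cmod (k x))"
    using w(2) by (auto simp: norm_mult abs_mult mult.commute[of B] intro!: mult_left_mono)
qed

lemma integrable_mult_coef:
  assumes "integrable M k" "f \<in> L2 M" "g \<in> L2 M"
  shows "integrable M (\<lambda>x. k x * coef M f g x)"
  by (rule integrable_mult_bounded[OF assms(1) coef_measurable[OF assms(2,3)] coef_bound[OF assms(2,3)]])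

text \<open>Writing |h| as the square of \<open>r\<close> and applying Cauchy-Schwarz to
  \<open>r\<close> and r(x) f(-x + y) bounds the squared convolution at y by the L1 norm of h times
  \<integral> |h(x)| |f(-x + y)|^2 dx. By Fubini and left invariance this is integrable in y; the
  bound holds at almost every y, where the slice of \<open>q\<close> is integrable.\<close>

lemma conv_op_L2:
  assumes h: "integrable M h" and f: "f \<in> L2 M"
  shows "conv_op M h f \<in> L2 M"
proof -
  note [measurable] = measurable_borel[OF borel_measurable_integrable[OF h]] L2_borel[OF f]
  define q where "q x y = cmod (h x) * (cmod (f (- x + y)))\<^sup>2" for x y
  have [measurable]: "case_prod q \<in> borel_measurable (M \<Otimes>\<^sub>M M)"
    unfolding q_def by measurable
  have q1: "integrable M (\<lambda>y. q x y)" for x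
    unfolding q_def by (intro integrable_mult_right integrable_left_transl L2_integrable f)
  have q2: "(LINT y|M. q x y) = cmod (h x) * (l2norm M f)\<^sup>2" for x
  proof -
    have "(LINT y|M. q x y) = cmod (h x) * (LINT y|M. (cmod (f (- x + y)))\<^sup>2)"
      unfolding q_def by simp
    also have "(LINT y|M. (cmod (f (- x + y)))\<^sup>2) = (l2norm M f)\<^sup>2"
      unfolding l2norm_power2 by (rule integral_left_transl[where f = "\<lambda>y. (cmod (f y))\<^sup>2"]) measurable
    finally show ?thesis .
  qed
  have q0: "0 \<le> q x y" for x y by (simp add: q_def)
  have qint: "integrable (M \<Otimes>\<^sub>M M) (case_prod q)"
  proof (rule pair.Fubini_integrable)
    show "integrable M (\<lambda>x. LINT y|M. norm (case_prod q (x, y)))"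
      using h by (simp add: q0 q2)
    show "AE x in M. integrable M (\<lambda>y. case_prod q (x, y))"
      using q1 by simp
  qed measurable
  define r where "r x = complex_of_real (sqrt (cmod (h x)))" for x
  have r: "r \<in> L2 M"
    unfolding L2_def r_def using h by (auto simp: norm_of_real)
  have bound: "AE y in M. (cmod (conv_op M h f y))\<^sup>2 \<le> (l2norm M r)\<^sup>2 * (LINT x|M. q x y)"
    using pair.AE_integrable_snd[OF qint]
  proof eventually_elim
    fix y assume y: "integrable M (\<lambda>x. q x y)"
    define s where "s x = r x * f (- x + y)" for x
    have sq: "(cmod (s x))\<^sup>2 = q x y" for x
      by (simp add: s_def q_def r_def norm_mult power_mult_distrib)
    have "s \<in> borel_measurable M" unfolding s_def r_def by measurable
    then have s: "s \<in> L2 M"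
      using y by (simp add: L2_def sq)
    have rs: "cmod (r x) * cmod (s x) = cmod (h x * f (- x + y))" for x
      by (simp add: s_def r_def norm_mult mult.assoc[symmetric])
    have "cmod (conv_op M h f y) \<le> (LINT x|M. cmod (h x * f (- x + y)))"
      unfolding conv_op_def by (rule integral_norm_bound)
    also have "\<dots> \<le> l2norm M r * l2norm M s"
      using L2_Cauchy_Schwarz[OF r s] by (simp only: rs)
    finally have "(cmod (conv_op M h f y))\<^sup>2 \<le> (l2norm M r * l2norm M s)\<^sup>2"
      by (rule power_mono) simp
    also have "\<dots> = (l2norm M r)\<^sup>2 * (LINT x|M. q x y)"
      by (simp add: power_mult_distrib l2norm_power2[of M s] sq)
    finally show "(cmod (conv_op M h f y))\<^sup>2 \<le> (l2norm M r)\<^sup>2 * (LINT x|M. q x y)" .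
  qed
  have m [measurable]: "conv_op M h f \<in> borel_measurable M"
    unfolding conv_op_def by measurable
  have "integrable M (\<lambda>y. (cmod (conv_op M h f y))\<^sup>2)"
  proof (rule Bochner_Integration.integrable_bound)
    show "integrable M (\<lambda>y. (l2norm M r)\<^sup>2 * (LINT x|M. q x y))"
      using pair.integrable_snd[OF qint] by simp
    show "AE y in M. norm ((cmod (conv_op M h f y))\<^sup>2) \<le> norm ((l2norm M r)\<^sup>2 * (LINT x|M. q x y))"
      using bound by eventually_elim simp
  qed measurable
  then show ?thesis using m by (simp add: L2_def)
qed

text \<open>Fubini's theorem; the integrand is absolutely integrable because Cauchy-Schwarz and
  invariance bound its inner integral by |h(x)| times the product of the norms of f and g.\<close>

lemma l2inner_conv_op:
  assumes h: "integrable M h" and f: "f \<in> L2 M" and g: "g \<in> L2 M"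
  shows "l2inner M (conv_op M h f) g = (LINT x|M. h x * coef M f g x)"
proof -
  note [measurable] = measurable_borel[OF borel_measurable_integrable[OF h]] L2_borel[OF f] L2_borel[OF g]
  define p where "p x y = h x * (left_transl x f y * cnj (g y))" for x y
  have [measurable]: "case_prod p \<in> borel_measurable (M \<Otimes>\<^sub>M M)"
    unfolding p_def left_transl_def by measurable
  have p1: "integrable M (\<lambda>y. p x y)" for x
    unfolding p_def by (intro integrable_mult_right L2_inner_integrable L2_left_transl f g)
  have pint: "integrable (M \<Otimes>\<^sub>M M) (case_prod p)"
  proof (rule pair.Fubini_integrable)
    show "integrable M (\<lambda>x. LINT y|M. norm (case_prod p (x, y)))"
    proof (rule Bochner_Integration.integrable_bound)
      show "integrable M (\<lambda>x. cmod (h x) * (l2norm M f * l2norm M g))" using h by simp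
      show "(\<lambda>x. LINT y|M. norm (case_prod p (x, y))) \<in> borel_measurable M"
        by measurable
      have "(LINT y|M. cmod (p x y)) \<le> cmod (h x) * (l2norm M f * l2norm M g)" for x
        using mult_left_mono[OF L2_Cauchy_Schwarz[OF L2_left_transl[OF f, of x] g], of "cmod (h x)"] f
        by (simp add: p_def norm_mult l2norm_left_transl)
      then show "AE x in M. norm (LINT y|M. norm (case_prod p (x, y)))
          \<le> norm (cmod (h x) * (l2norm M f * l2norm M g))"
        by (simp add: abs_mult)
    qed
    show "AE x in M. integrable M (\<lambda>y. case_prod p (x, y))"
      using p1 by simp
  qed measurable
  have "l2inner M (conv_op M h f) g = (LINT y|M. LINT x|M. p x y)"
    unfolding l2inner_def conv_op_def p_def left_transl_def by (simp add: mult.assoc[symmetric])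
  also have "\<dots> = (LINT x|M. LINT y|M. p x y)"
    by (rule pair.Fubini_integral[OF pint])
  also have "\<dots> = (LINT x|M. h x * coef M f g x)"
    unfolding p_def coef_def l2inner_def by simp
  finally show ?thesis .
qed

text \<open>Almost everywhere equality survives every translation because the measure equals its
  push-forward; the coefficient functions therefore agree at every point.\<close>

lemma coef_cong_AE:
  assumes "f \<in> L2 M" "f' \<in> L2 M" "g \<in> L2 M" "AE x in M. f x = f' x"
  shows "coef M f g = coef M f' g"
proof
  fix x
  have "(\<lambda>y. - x + y) \<in> measurable M M" by measurable
  moreover have "AE y in distr M M (\<lambda>y. - x + y). f y = f' y"
    using assms(4) by (simp only: distr_left_transl)
  ultimately have "AE y in M. f (- x + y) = f' (- x + y)"
    by (rule AE_distrD)
  then show "coef M f g x = coef M f' g x"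
    unfolding coef_def using assms
    by (intro l2inner_cong_AE L2_left_transl) (auto simp: left_transl_def)
qed

lemma coef_linear_left:
  assumes "f \<in> L2 M" "f' \<in> L2 M" "g \<in> L2 M"
  shows "coef M (\<lambda>y. f y + c * f' y) g x = coef M f g x + c * coef M f' g x"
  using l2inner_add_left[OF L2_left_transl[OF assms(1)] L2_left_transl[OF assms(2)] assms(3)]
  by (simp add: coef_def left_transl_def)

text \<open>The integral defining \<open>conv_op\<close> need not converge at every point.
  Congruence and linearity are therefore verified after pairing with test functions, where they
  become properties of coefficient functions. The operator bound is the L1 norm of h.\<close>

lemma conv_op_bdd:
  assumes h: "integrable M h"
  shows "bdd_op M (conv_op M h)"
  unfolding bdd_op_def
proof (intro conjI ballI allI impI)
  fix f assume f: "f \<in> L2 M"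
  then show "conv_op M h f \<in> L2 M" by (rule conv_op_L2[OF h])
  fix g assume g: "g \<in> L2 M"
  show "AE x in M. conv_op M h f x = conv_op M h g x" if "AE x in M. f x = g x"
    using that
    by (intro L2_AE_eqI conv_op_L2 h f g) (simp add: l2inner_conv_op h f g coef_cong_AE[OF f g])
  fix c :: complex
  have fg: "(\<lambda>y. f y + c * g y) \<in> L2 M" by (intro L2_add L2_cmult f g)
  show "AE x in M. conv_op M h (\<lambda>y. f y + c * g y) x = conv_op M h f x + c * conv_op M h g x"
  proof (rule L2_AE_eqI)
    fix k assume k: "k \<in> L2 M"
    have "l2inner M (conv_op M h (\<lambda>y. f y + c * g y)) k
        = (LINT x|M. h x * coef M f k x + c * (h x * coef M g k x))"
      by (simp add: l2inner_conv_op h fg k coef_linear_left f g algebra_simps)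
    also have "\<dots> = (LINT x|M. h x * coef M f k x) + c * (LINT x|M. h x * coef M g k x)"
      using h f g k by (subst Bochner_Integration.integral_add) (auto intro: integrable_mult_coef)
    also have "\<dots> = l2inner M (\<lambda>x. conv_op M h f x + c * conv_op M h g x) k"
      by (simp add: l2inner_add_left conv_op_L2 h f g k l2inner_conv_op)
    finally show "l2inner M (conv_op M h (\<lambda>y. f y + c * g y)) k
        = l2inner M (\<lambda>x. conv_op M h f x + c * conv_op M h g x) k" .
  qed (intro conv_op_L2 L2_add L2_cmult h f g fg)+
next
  have "l2norm M (conv_op M h f) \<le> (LINT x|M. cmod (h x)) * l2norm M f" if f: "f \<in> L2 M" for f
  proof (rule l2norm_le_of_inner_bound)
    fix g assume g: "g \<in> L2 M"
    have "cmod (l2inner M (conv_op M h f) g) \<le> (LINT x|M. cmod (h x * coef M f g x))"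
      unfolding l2inner_conv_op[OF h f g] by (rule integral_norm_bound)
    also have "\<dots> \<le> (LINT x|M. cmod (h x) * (l2norm M f * l2norm M g))"
      using h f g
      by (intro integral_mono integrable_norm integrable_mult_coef)
         (auto simp: norm_mult intro!: mult_left_mono coef_bound)
    finally show "cmod (l2inner M (conv_op M h f) g) \<le> (LINT x|M. cmod (h x)) * l2norm M f * l2norm M g"
      by (simp add: mult.assoc)
  qed (use h f in \<open>auto intro: conv_op_L2 integral_nonneg_AE\<close>)
  then show "\<exists>C. \<forall>f\<in>L2 M. l2norm M (conv_op M h f) \<le> C * l2norm M f" by blast
qed

text \<open>Matrix coefficients of the convolution operator are integrals of coefficient functions
  against h. Replacing these integrals by point evaluations replaces the operator by a combination
  of translations, with no error on the finitely many pairs given.\<close>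

lemma conv_op_eq_lambda_span:
  assumes h: "integrable M h" and fg: "\<And>i. i < n \<Longrightarrow> f i \<in> L2 M \<and> g i \<in> L2 M"
  shows "\<exists>S\<in>lambda_span M. \<forall>i<(n::nat). l2inner M (conv_op M h (f i)) (g i) = l2inner M (S (f i)) (g i)"
proof -
  have "\<exists>xs. \<forall>i<n. (LINT x|M. h x * coef M (f i) (g i) x) = point_eval xs (coef M (f i) (g i))"
    by (rule integral_eq_point_evaluations) (use fg in \<open>auto intro: integrable_mult_coef[OF h]\<close>)
  then obtain xs where xs: "\<forall>i<n. (LINT x|M. h x * coef M (f i) (g i) x) = point_eval xs (coef M (f i) (g i))"
    ..
  define S where "S = (\<lambda>f y. \<Sum>j<length xs. fst (xs ! j) * left_transl (snd (xs ! j)) f y)"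
  have "S \<in> lambda_span M" unfolding lambda_span_def
    by (intro CollectI exI[of _ "length xs"] exI[of _ "\<lambda>j. fst (xs ! j)"] exI[of _ "\<lambda>j. snd (xs ! j)"])
       (rule S_def)
  moreover have "l2inner M (conv_op M h (f i)) (g i) = l2inner M (S (f i)) (g i)" if i: "i < n" for i
  proof -
    have fi: "f i \<in> L2 M" and gi: "g i \<in> L2 M" using fg[OF i] by auto
    have "l2inner M (S (f i)) (g i)
        = (LINT y|M. (\<Sum>j<length xs. fst (xs ! j) * (left_transl (snd (xs ! j)) (f i) y * cnj (g i y))))"
      unfolding l2inner_def S_def by (simp add: sum_distrib_right mult.assoc)
    also have "\<dots> = (\<Sum>j<length xs. fst (xs ! j) * coef M (f i) (g i) (snd (xs ! j)))"
      using L2_inner_integrable[OF L2_left_transl[OF fi] gi]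
      by (subst Bochner_Integration.integral_sum) (auto simp: coef_def l2inner_def)
    also have "\<dots> = point_eval xs (coef M (f i) (g i))"
      unfolding point_eval_def
      by (simp add: sum_list_sum_nth atLeast0LessThan split_beta)
    also have "\<dots> = l2inner M (conv_op M h (f i)) (g i)"
      by (simp add: xs[rule_format, OF i] l2inner_conv_op h fi gi)
    finally show ?thesis by simp
  qed
  ultimately show ?thesis by blast
qed

end

section \<open>Fourier algebra and reduced group algebra\<close>

lemma tendsto_of_geometric_bound:
  fixes z :: "nat \<Rightarrow> complex"
  assumes "\<And>n. cmod (s - z n) \<le> c * (1/2) ^ n"
  shows "z \<longlonglongrightarrow> s"
proof -
  have "(\<lambda>n. c * (1/2) ^ n) \<longlonglongrightarrow> c * 0"
    by (intro tendsto_mult tendsto_const LIMSEQ_power_zero) simp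
  then have lim: "(\<lambda>n. c * (1/2) ^ n) \<longlonglongrightarrow> 0" by simp
  have "eventually (\<lambda>n. norm (z n - s) \<le> c * (1/2) ^ n) sequentially"
    using assms by (intro always_eventually allI) (simp only: norm_minus_commute)
  from Lim_null_comparison[OF this lim] show ?thesis by (rule LIM_zero_cancel)
qed

context haar_group
begin

section \<open>Representations of Fourier algebra elements and their pairing with operators\<close>

lemma coef_zero_left [simp]: "coef M (\<lambda>_. 0) g x = 0"
  by (simp add: coef_def left_transl_def l2inner_def)

lemma A_rep_coef:
  assumes "f \<in> L2 M" "g \<in> L2 M"
  shows "A_rep M (coef M f g) (\<lambda>n. if n = 0 then f else (\<lambda>_. 0)) (\<lambda>n. if n = 0 then g else (\<lambda>_. 0))"
proof -
  have 1: "(\<lambda>n. l2norm M (if n = 0 then f else (\<lambda>_. 0)) * l2norm M (if n = 0 then g else (\<lambda>_. 0)))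
      = (\<lambda>n::nat. if n = 0 then l2norm M f * l2norm M g else 0)"
    by (auto simp: fun_eq_iff)
  have 2: "(\<lambda>n. coef M (if n = 0 then f else (\<lambda>_. 0)) (if n = 0 then g else (\<lambda>_. 0)) x)
      = (\<lambda>n::nat. if n = 0 then coef M f g x else 0)" for x
    by (auto simp: fun_eq_iff)
  show ?thesis
    unfolding A_rep_def 1 2
    using assms sums_single[of 0 "\<lambda>n. coef M f g _"] summable_single[of 0 "\<lambda>n. l2norm M f * l2norm M g"]
    by simp
qed

text \<open>No linearity of \<open>R\<close> enters: the terms with positive index vanish because
  their second entry is zero.\<close>

lemma suminf_l2inner_single:
  "(\<Sum>n::nat. l2inner M (R (if n = 0 then f else (\<lambda>_. 0))) (if n = 0 then g else (\<lambda>_. 0)))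
    = l2inner M (R f) g"
proof -
  have "(\<lambda>n::nat. l2inner M (R (if n = 0 then f else (\<lambda>_. 0))) (if n = 0 then g else (\<lambda>_. 0)))
      = (\<lambda>n. if n = 0 then l2inner M (R f) g else 0)"
    by (auto simp: l2inner_def fun_eq_iff)
  then show ?thesis using sums_single[of 0 "\<lambda>n. l2inner M (R f) g"] by (simp add: sums_iff)
qed

lemma A_rep_bounded:
  assumes u: "A_rep M u a b"
  shows "cmod (u x) \<le> (\<Sum>n. l2norm M (a n) * l2norm M (b n))"
proof -
  have "u x = (\<Sum>n. coef M (a n) (b n) x)"
    using u by (simp add: A_rep_def sums_iff)
  also have "cmod \<dots> \<le> (\<Sum>n. l2norm M (a n) * l2norm M (b n))"
    using u by (intro norm_suminf_le coef_bound) (auto simp: A_rep_def)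
  finally show ?thesis .
qed

lemma A_rep_measurable:
  assumes u: "A_rep M u a b"
  shows "u \<in> borel_measurable M"
proof -
  have "u = (\<lambda>x. \<Sum>n. coef M (a n) (b n) x)"
    using u by (simp add: A_rep_def sums_iff fun_eq_iff)
  moreover have [measurable]: "coef M (a n) (b n) \<in> borel_measurable M" for n
    using u by (intro coef_measurable) (auto simp: A_rep_def)
  ultimately show ?thesis by simp
qed

text \<open>Sum and integral are interchanged; the n-th term is dominated by |k| times the product
  of the norms of \<open>a n\<close> and \<open>b n\<close>, which is summable in n and integrable
  in x.\<close>

lemma A_rep_pairing:
  assumes u: "A_rep M u a b" and k: "integrable M k"
  shows "(\<lambda>n. LINT x|M. k x * coef M (a n) (b n) x) sums (LINT x|M. k x * u x)"
proof -
  let ?B = "\<lambda>n. l2norm M (a n) * l2norm M (b n)"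
  have L: "a n \<in> L2 M" "b n \<in> L2 M" for n using u by (auto simp: A_rep_def)
  have sB: "summable ?B" using u by (simp add: A_rep_def)
  have bd: "cmod (k x * coef M (a n) (b n) x) \<le> cmod (k x) * ?B n" for n x
    unfolding norm_mult by (intro mult_left_mono coef_bound L) simp
  have int: "integrable M (\<lambda>x. k x * coef M (a n) (b n) x)" for n
    by (rule integrable_mult_coef[OF k L])
  have "(\<lambda>n. LINT x|M. k x * coef M (a n) (b n) x) sums (LINT x|M. (\<Sum>n. k x * coef M (a n) (b n) x))"
  proof (rule sums_integral[OF int])
    show "AE x in M. summable (\<lambda>n. norm (k x * coef M (a n) (b n) x))"
    proof (rule AE_I2)
      fix x
      show "summable (\<lambda>n. norm (k x * coef M (a n) (b n) x))"
        by (rule summable_comparison_test'[OF summable_mult[OF sB]]) (use bd in simp)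
    qed
    have "(LINT x|M. norm (k x * coef M (a n) (b n) x)) \<le> (LINT x|M. cmod (k x)) * ?B n" for n
    proof -
      have "(LINT x|M. norm (k x * coef M (a n) (b n) x)) \<le> (LINT x|M. cmod (k x) * ?B n)"
        using k int bd by (intro integral_mono) auto
      then show ?thesis by simp
    qed
    then show "summable (\<lambda>n. LINT x|M. norm (k x * coef M (a n) (b n) x))"
      by (intro summable_comparison_test'[OF summable_mult[OF sB, of "LINT x|M. cmod (k x)"], of 0])
         (simp add: abs_of_nonneg integral_nonneg_AE)
  qed
  moreover have "(\<Sum>n. k x * coef M (a n) (b n) x) = k x * u x" for x
    using u by (intro sums_unique[symmetric] sums_mult) (auto simp: A_rep_def)
  ultimately show ?thesis by simp
qed

text \<open>The errors of the single matrix coefficients are summed along the representation. The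
  integral of k u depends on the function u only, which makes pairings with different
  representations, and on different groups, comparable.\<close>

lemma pairing_approx:
  assumes u: "A_rep M u a b" and k: "integrable M k"
    and T: "\<And>f g. f \<in> L2 M \<Longrightarrow> g \<in> L2 M \<Longrightarrow>
      cmod (l2inner M (T f) g - (LINT x|M. k x * coef M f g x)) \<le> e * (l2norm M f * l2norm M g)"
  shows "cmod ((\<Sum>n. l2inner M (T (a n)) (b n)) - (LINT x|M. k x * u x))
    \<le> e * (\<Sum>n. l2norm M (a n) * l2norm M (b n))"
proof -
  define d where "d n = l2inner M (T (a n)) (b n) - (LINT x|M. k x * coef M (a n) (b n) x)" for n
  let ?B = "\<lambda>n. l2norm M (a n) * l2norm M (b n)"
  have sB: "summable ?B" using u by (simp add: A_rep_def)
  have d: "cmod (d n) \<le> e * ?B n" for n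
    unfolding d_def using u by (intro T) (auto simp: A_rep_def)
  have sd: "summable d"
    by (rule summable_comparison_test'[OF summable_mult[OF sB, of e], of 0]) (rule d)
  note s = A_rep_pairing[OF u k]
  have "(\<lambda>n. d n + (LINT x|M. k x * coef M (a n) (b n) x)) sums (suminf d + (LINT x|M. k x * u x))"
    by (intro sums_add summable_sums[OF sd] s)
  then have "(\<Sum>n. l2inner M (T (a n)) (b n)) = suminf d + (LINT x|M. k x * u x)"
    unfolding d_def by (simp add: sums_iff)
  then have "cmod ((\<Sum>n. l2inner M (T (a n)) (b n)) - (LINT x|M. k x * u x)) = cmod (suminf d)"
    by simp
  also have "\<dots> \<le> (\<Sum>n. e * ?B n)"
    by (intro norm_suminf_le d summable_mult sB)
  finally show ?thesis by (simp add: suminf_mult[OF sB])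
qed

text \<open>Approximation in operator norm becomes, through \<open>l2inner_conv_op\<close> and
  Cauchy-Schwarz, an estimate of matrix coefficients that is uniform in f and g.\<close>

lemma Cr_approx:
  assumes T: "T \<in> Cr M" and e: "0 < e"
  obtains k where "integrable M k"
    "\<And>f g. f \<in> L2 M \<Longrightarrow> g \<in> L2 M \<Longrightarrow>
      cmod (l2inner M (T f) g - (LINT x|M. k x * coef M f g x)) \<le> e * (l2norm M f * l2norm M g)"
proof -
  from T e obtain k where k: "integrable M k"
    and op: "op_norm M (\<lambda>f y. T f y - conv_op M k f y) < e" and Tb: "bdd_op M T"
    unfolding Cr_def by blast
  show thesis
  proof (rule that[OF k])
    fix f g assume f: "f \<in> L2 M" and g: "g \<in> L2 M"
    note Tf = bdd_op_L2[OF Tb f] and kf = conv_op_L2[OF k f]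
    have "cmod (l2inner M (T f) g - (LINT x|M. k x * coef M f g x))
        = cmod (l2inner M (\<lambda>y. T f y - conv_op M k f y) g)"
      by (simp add: l2inner_diff_left[OF Tf kf g] l2inner_conv_op[OF k f g])
    also have "\<dots> \<le> l2norm M (\<lambda>y. T f y - conv_op M k f y) * l2norm M g"
      by (intro l2inner_bound L2_diff Tf kf g)
    also have "\<dots> \<le> (op_norm M (\<lambda>f y. T f y - conv_op M k f y) * l2norm M f) * l2norm M g"
      by (intro mult_right_mono l2norm_le_op_norm[OF bdd_op_diff[OF Tb conv_op_bdd[OF k]] f]) simp
    also have "\<dots> \<le> (e * l2norm M f) * l2norm M g"
      using op by (intro mult_right_mono) auto
    finally show "cmod (l2inner M (T f) g - (LINT x|M. k x * coef M f g x)) \<le> e * (l2norm M f * l2norm M g)"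
      by (simp add: mult.assoc)
  qed
qed

text \<open>An operator is approximated in norm by a convolution operator, whose matrix coefficients
  at finitely many pairs are reproduced exactly by a combination of translations. This is membership
  in the weak operator closure.\<close>

lemma Cr_subset_VN: "Cr M \<subseteq> VN M"
proof
  fix T assume T: "T \<in> Cr M"
  have "\<exists>S\<in>lambda_span M. \<forall>i<n. cmod (l2inner M (T (f i)) (g i) - l2inner M (S (f i)) (g i)) < \<epsilon>"
    if fg: "\<forall>i<n. f i \<in> L2 M \<and> g i \<in> L2 M" and \<epsilon>: "0 < \<epsilon>" for n :: nat and f g \<epsilon>
  proof -
    \<comment> \<open>The summand 1 makes \<open>B\<close> positive and strictly larger than each
      product of norms, which gives the strict inequality at the end.\<close>
    define B where "B = (\<Sum>i<n. l2norm M (f i) * l2norm M (g i)) + 1"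
    have B: "0 < B" unfolding B_def by (intro add_nonneg_pos sum_nonneg) auto
    have Bi: "l2norm M (f i) * l2norm M (g i) < B" if "i < n" for i
      unfolding B_def using that
        member_le_sum[of i "{..<n}" "\<lambda>i. l2norm M (f i) * l2norm M (g i)"] by simp
    have eB: "0 < \<epsilon> / B" using \<epsilon> B by simp
    obtain k where k: "integrable M k" and Tk: "\<And>f g. f \<in> L2 M \<Longrightarrow> g \<in> L2 M \<Longrightarrow>
        cmod (l2inner M (T f) g - (LINT x|M. k x * coef M f g x)) \<le> \<epsilon> / B * (l2norm M f * l2norm M g)"
      by (rule Cr_approx[OF T eB]) blast
    have "\<exists>S\<in>lambda_span M. \<forall>i<n. l2inner M (conv_op M k (f i)) (g i) = l2inner M (S (f i)) (g i)"
      by (rule conv_op_eq_lambda_span[OF k]) (use fg in blast)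
    then obtain S where S: "S \<in> lambda_span M"
      "\<And>i. i < n \<Longrightarrow> l2inner M (conv_op M k (f i)) (g i) = l2inner M (S (f i)) (g i)"
      by blast
    have "cmod (l2inner M (T (f i)) (g i) - l2inner M (S (f i)) (g i)) < \<epsilon>" if i: "i < n" for i
    proof -
      have L: "f i \<in> L2 M" "g i \<in> L2 M" using fg i by auto
      have "cmod (l2inner M (T (f i)) (g i) - l2inner M (S (f i)) (g i))
          \<le> \<epsilon> / B * (l2norm M (f i) * l2norm M (g i))"
        using Tk[OF L] by (simp add: S(2)[OF i, symmetric] l2inner_conv_op[OF k L])
      also have "\<dots> < \<epsilon> / B * B"
        using Bi[OF i] eB by (intro mult_strict_left_mono)
      finally show ?thesis using B by simp
    qed
    then show ?thesis using S(1) by blast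
  qed
  moreover have "bdd_op M T" using T by (simp add: Cr_def)
  ultimately show "T \<in> VN M" unfolding VN_def by simp
qed

section \<open>Reduction to compact supports and cut-off functions\<close>

lemma L2_restrict:
  assumes f: "f \<in> L2 M" and A: "A \<in> sets M"
  shows "(\<lambda>x. indicator A x * f x) \<in> L2 M"
proof -
  have m: "(\<lambda>x. indicator A x * f x) \<in> borel_measurable M"
    using f A by measurable
  moreover have "integrable M (\<lambda>x. (cmod (indicator A x * f x))\<^sup>2)"
    by (rule Bochner_Integration.integrable_bound[OF L2_integrable[OF f]])
       (use m in \<open>auto simp: indicator_def\<close>)
  ultimately show ?thesis by (simp add: L2_def)
qed

text \<open>Dominated convergence with majorant |f|^2: each point eventually lies in
  \<open>K n\<close>, from where on the integrand is 0 there.\<close>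

lemma l2norm_restrict_tendsto:
  assumes f: "f \<in> L2 M" and K: "\<And>n::nat. K n \<in> sets M" "incseq K" "(\<Union>n. K n) = UNIV"
  shows "(\<lambda>n. l2norm M (\<lambda>x. f x - indicator (K n) x * f x)) \<longlonglongrightarrow> 0"
proof -
  have "(\<lambda>n. LINT x|M. (cmod (f x - indicator (K n) x * f x))\<^sup>2) \<longlonglongrightarrow> (LINT x|M. 0)"
  proof (rule integral_dominated_convergence)
    show "integrable M (\<lambda>x. (cmod (f x))\<^sup>2)" by (rule L2_integrable[OF f])
    show "(\<lambda>x. (cmod (f x - indicator (K n) x * f x))\<^sup>2) \<in> borel_measurable M" for n
      using L2_integrable[OF L2_diff[OF f L2_restrict[OF f K(1)]]] by (rule borel_measurable_integrable)
    show "AE x in M. norm ((cmod (f x - indicator (K n) x * f x))\<^sup>2) \<le> (cmod (f x))\<^sup>2" for n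
      by (auto simp: indicator_def)
    show "AE x in M. (\<lambda>n. (cmod (f x - indicator (K n) x * f x))\<^sup>2) \<longlonglongrightarrow> 0"
    proof (rule AE_I2)
      fix x
      have "x \<in> (\<Union>n. K n)" using K(3) by simp
      then obtain N where "x \<in> K N" by blast
      then have "x \<in> K n" if "N \<le> n" for n
        using incseqD[OF K(2) that] by blast
      then have "eventually (\<lambda>n. (cmod (f x - indicator (K n) x * f x))\<^sup>2 = 0) sequentially"
        by (intro eventually_sequentiallyI[of N]) simp
      then show "(\<lambda>n. (cmod (f x - indicator (K n) x * f x))\<^sup>2) \<longlonglongrightarrow> 0"
        by (rule tendsto_eventually)
    qed
  qed simp
  then show ?thesis
    unfolding l2norm_def using tendsto_real_sqrt by fastforce
qed

text \<open>Restricting f and then g to members of a compact exhaustion changes the matrix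
  coefficient by arbitrarily little, so it stays nonzero for suitable restrictions. The union of the
  two compact sets used contains both supports.\<close>

lemma nonzero_op_compact_support:
  assumes T: "bdd_op M T" and nz: "nonzero_op M T"
  obtains f g K where "f \<in> L2 M" "g \<in> L2 M" "compact K"
    "\<And>x. x \<notin> K \<Longrightarrow> f x = 0" "\<And>x. x \<notin> K \<Longrightarrow> g x = 0" "l2inner M (T f) g \<noteq> 0"
proof -
  obtain f g where f: "f \<in> L2 M" and g: "g \<in> L2 M" and fg: "l2inner M (T f) g \<noteq> 0"
    using nz by (auto simp: nonzero_op_def)
  obtain C where C: "0 \<le> C" "\<And>f. f \<in> L2 M \<Longrightarrow> l2norm M (T f) \<le> C * l2norm M f"
    by (rule bdd_op_bound[OF T]) blast
  obtain K :: "nat \<Rightarrow> 'a set" where K: "\<And>n. compact (K n)" "incseq K" "(\<Union>n. K n) = UNIV"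
    by (rule compact_exhaustion) blast
  note KM = compact_in_sets[OF K(1)]
  define r where "r n h = (\<lambda>x. indicator (K n) x * h x)" for n and h :: "'a \<Rightarrow> complex"
  have r: "r n h \<in> L2 M" if "h \<in> L2 M" for n h
    unfolding r_def by (rule L2_restrict[OF that KM])
  have lim: "(\<lambda>n. l2norm M (\<lambda>x. h x - r n h x)) \<longlonglongrightarrow> 0" if "h \<in> L2 M" for h
    unfolding r_def by (rule l2norm_restrict_tendsto[OF that KM K(2,3)])
  have "(\<lambda>n. l2inner M (T f) g - l2inner M (T (r n f)) g) \<longlonglongrightarrow> 0"
  proof (rule Lim_null_comparison)
    show "eventually (\<lambda>n. norm (l2inner M (T f) g - l2inner M (T (r n f)) g)
        \<le> C * l2norm M (\<lambda>x. f x - r n f x) * l2norm M g) sequentially"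
    proof (rule always_eventually, rule allI)
      fix n
      have "cmod (l2inner M (T (\<lambda>x. f x - r n f x)) g) \<le> l2norm M (T (\<lambda>x. f x - r n f x)) * l2norm M g"
        by (intro l2inner_bound bdd_op_L2[OF T] L2_diff f g r)
      also have "\<dots> \<le> C * l2norm M (\<lambda>x. f x - r n f x) * l2norm M g"
        by (intro mult_right_mono C(2) L2_diff f r) simp
      finally show "norm (l2inner M (T f) g - l2inner M (T (r n f)) g)
          \<le> C * l2norm M (\<lambda>x. f x - r n f x) * l2norm M g"
        by (simp add: bdd_op_inner_diff[OF T f r[OF f] g])
    qed
    have "(\<lambda>n. C * l2norm M (\<lambda>x. f x - r n f x) * l2norm M g) \<longlonglongrightarrow> C * 0 * l2norm M g"
      by (intro tendsto_mult tendsto_const lim f)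
    then show "(\<lambda>n. C * l2norm M (\<lambda>x. f x - r n f x) * l2norm M g) \<longlonglongrightarrow> 0" by simp
  qed
  then have "(\<lambda>n. l2inner M (T f) g - (l2inner M (T f) g - l2inner M (T (r n f)) g)) \<longlonglongrightarrow> l2inner M (T f) g - 0"
    by (intro tendsto_diff tendsto_const)
  then have "(\<lambda>n. l2inner M (T (r n f)) g) \<longlonglongrightarrow> l2inner M (T f) g" by simp
  then have "eventually (\<lambda>n. l2inner M (T (r n f)) g \<noteq> 0) sequentially"
    using fg by (rule tendsto_imp_eventually_ne)
  then obtain n where n: "l2inner M (T (r n f)) g \<noteq> 0"
    by (meson eventually_happens trivial_limit_sequentially)
  note Tf = bdd_op_L2[OF T r[OF f, of n]]
  have "(\<lambda>m. l2inner M (T (r n f)) g - l2inner M (T (r n f)) (r m g)) \<longlonglongrightarrow> 0"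
  proof (rule Lim_null_comparison)
    show "eventually (\<lambda>m. norm (l2inner M (T (r n f)) g - l2inner M (T (r n f)) (r m g))
        \<le> l2norm M (T (r n f)) * l2norm M (\<lambda>x. g x - r m g x)) sequentially"
      using l2inner_bound[OF Tf L2_diff[OF g r[OF g]]]
      by (intro always_eventually) (simp add: l2inner_diff_right[OF g r[OF g] Tf])
    have "(\<lambda>m. l2norm M (T (r n f)) * l2norm M (\<lambda>x. g x - r m g x)) \<longlonglongrightarrow> l2norm M (T (r n f)) * 0"
      by (intro tendsto_mult tendsto_const lim g)
    then show "(\<lambda>m. l2norm M (T (r n f)) * l2norm M (\<lambda>x. g x - r m g x)) \<longlonglongrightarrow> 0" by simp
  qed
  then have "(\<lambda>m. l2inner M (T (r n f)) g - (l2inner M (T (r n f)) g - l2inner M (T (r n f)) (r m g)))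
      \<longlonglongrightarrow> l2inner M (T (r n f)) g - 0"
    by (intro tendsto_diff tendsto_const)
  then have "(\<lambda>m. l2inner M (T (r n f)) (r m g)) \<longlonglongrightarrow> l2inner M (T (r n f)) g" by simp
  then have "eventually (\<lambda>m. l2inner M (T (r n f)) (r m g) \<noteq> 0) sequentially"
    using n by (rule tendsto_imp_eventually_ne)
  then obtain m where m: "l2inner M (T (r n f)) (r m g) \<noteq> 0"
    by (meson eventually_happens trivial_limit_sequentially)
  show thesis
    by (rule that[OF r[OF f] r[OF g] _ _ _ m, of "K n \<union> K m"]) (use K(1) in \<open>auto simp: r_def\<close>)
qed

text \<open>If the integrand is nonzero at y, then y and -x + y lie in \<open>K\<close>, and x = y -
  (-x + y) is a difference of elements of \<open>K\<close>.\<close>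

lemma coef_eq_0_outside:
  assumes "\<And>x. x \<notin> K \<Longrightarrow> f x = 0" "\<And>x. x \<notin> K \<Longrightarrow> g x = 0"
    and x: "x \<notin> (\<lambda>(a, b). a - b) ` (K \<times> K)"
  shows "coef M f g x = 0"
proof -
  have "f (- x + y) * cnj (g y) = 0" for y
  proof (rule ccontr)
    assume *: "f (- x + y) * cnj (g y) \<noteq> 0"
    then have "- x + y \<in> K" "y \<in> K" using assms(1,2) by force+
    moreover have "x = y - (- x + y)" by (simp add: diff_conv_add_uminus minus_add add.assoc[symmetric])
    ultimately show False using x by force
  qed
  then have "(LINT y|M. f (- x + y) * cnj (g y)) = (LINT y|M. 0)"
    by (intro Bochner_Integration.integral_cong) auto
  then show ?thesis by (simp add: coef_def l2inner_def left_transl_def)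
qed

lemma indicator_L2:
  assumes K: "compact K"
  shows "(\<lambda>x. c * indicator K x) \<in> L2 M"
proof -
  have "integrable M (indicator K :: 'a \<Rightarrow> real)"
    using emeasure_compact[OF K] compact_in_sets[OF K] by simp
  then have "integrable M (\<lambda>x. (cmod (indicator K x))\<^sup>2)"
    by (rule Bochner_Integration.integrable_cong[THEN iffD1, rotated 2]) (auto simp: indicator_def)
  moreover have "indicator K \<in> borel_measurable M" 
    using compact_in_sets[OF K] by measurable
  ultimately have "(indicator K :: 'a \<Rightarrow> complex) \<in> L2 M" by (simp add: L2_def)
  then show ?thesis by (rule L2_cmult)
qed

text \<open>\<open>C\<close> is a compact set of positive finite measure, \<psi> its normalised
  indicator and \<phi> the indicator of -L + C. For x in \<open>L\<close> the translate of \<phi> is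
  1 on all of \<open>C\<close>, so the coefficient is the integral of \<psi>. Such a function serves
  as a cut-off in the Fourier algebra.\<close>

lemma coef_eq_1_on_compact:
  assumes L: "compact L"
  obtains \<phi> \<psi> where "\<phi> \<in> L2 M" "\<psi> \<in> L2 M" "\<And>x. x \<in> L \<Longrightarrow> coef M \<phi> \<psi> x = 1"
proof -
  obtain U C :: "'a set" where U: "open U" "compact C" "0 \<in> U" "U \<subseteq> C"
    by (rule compact_neighbourhood)
  have "0 < emeasure M U" using haar U(1,3) by (auto simp: haar_measure_def)
  also have "\<dots> \<le> emeasure M C" by (intro emeasure_mono U compact_in_sets)
  finally have m: "0 < measure M C"
    using emeasure_compact[OF U(2)] by (simp add: measure_def enn2real_positive_iff)
  define D where "D = (\<lambda>(x, y). - x + y) ` (L \<times> C)"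
  have D: "compact D"
    unfolding D_def
    by (rule compact_continuous_image[OF _ compact_Times[OF L U(2)]])
       (auto simp: split_beta intro!: continuous_intros)
  \<comment> \<open>The factor 1 gives \<phi> the shape required by
    \<open>indicator_L2\<close>.\<close>
  define \<phi> :: "'a \<Rightarrow> complex" where "\<phi> x = 1 * indicator D x" for x
  define \<psi> :: "'a \<Rightarrow> complex" where "\<psi> x = of_real (1 / measure M C) * indicator C x" for x
  show thesis
  proof (rule that)
    show "\<phi> \<in> L2 M" "\<psi> \<in> L2 M"
      unfolding \<phi>_def \<psi>_def by (intro indicator_L2 D U)+
    fix x assume x: "x \<in> L"
    have "\<phi> (- x + y) * cnj (\<psi> y) = of_real (1 / measure M C * indicator C y)" for y
    proof (cases "y \<in> C")
      case True
      then have "- x + y \<in> D" unfolding D_def using x by force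
      then show ?thesis using True by (simp add: \<phi>_def \<psi>_def)
    qed (simp add: \<psi>_def)
    then have "coef M \<phi> \<psi> x = (LINT y|M. complex_of_real (1 / measure M C * indicator C y))"
      unfolding coef_def l2inner_def left_transl_def by simp
    also have "\<dots> = of_real (1 / measure M C * (LINT y|M. indicator C y))"
      by (simp only: integral_complex_of_real integral_mult_right_zero)
    also have "\<dots> = 1"
      using m compact_in_sets[OF U(2)] emeasure_compact[OF U(2)] by simp
    finally show "coef M \<phi> \<psi> x = 1" .
  qed
qed

end

section \<open>Transfer along a homomorphism\<close>

lemma closed_ideal_subset: "closed_ideal M J \<Longrightarrow> J \<subseteq> fourier_alg M"
  by (simp add: closed_ideal_def)

lemma closed_ideal_mult:
  "closed_ideal M J \<Longrightarrow> u \<in> J \<Longrightarrow> v \<in> fourier_alg M \<Longrightarrow> (\<lambda>x. v x * u x) \<in> J"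
  by (simp add: closed_ideal_def)

locale haar_group_hom = G: haar_group \<mu> + H: haar_group \<nu>
  for \<mu> :: "'g::{topological_group_add, t2_space, second_countable_topology} measure"
    and \<nu> :: "'h::{topological_group_add, t2_space, second_countable_topology} measure" +
  fixes \<theta> :: "'g \<Rightarrow> 'h"
  assumes cont: "continuous_on UNIV \<theta>" and hom: "\<And>x y. \<theta> (x + y) = \<theta> x + \<theta> y"
    and ac: "absolutely_continuous \<nu> (distr \<mu> \<nu> \<theta>)"
begin

sublocale GH: pair_sigma_finite \<mu> \<nu> ..

lemma hom_measurable [measurable]: "\<theta> \<in> borel_measurable borel"
  by (rule borel_measurable_continuous_onI[OF cont])

lemma hom_uminus: "\<theta> (- x) = - \<theta> x"
proof -
  have "\<theta> 0 + \<theta> 0 = \<theta> 0 + 0" using hom[of 0 0] by simp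
  then have "\<theta> 0 = 0" by (rule add_left_imp_eq)
  then have "\<theta> x + \<theta> (- x) = 0" using hom[of x "- x"] by simp
  then show ?thesis by (rule minus_unique[symmetric])
qed

text \<open>The push-forward \<open>P\<close> of the finite measure with density q is absolutely
  continuous, since \<nu>-null sets have \<mu>-null preimages under \<theta>. Its Radon-Nikodym
  derivative has finite integral, hence is finite almost everywhere and can be replaced by a real
  function; both sides of the identity are the integral of \<open>w\<close> against
  \<open>P\<close>.\<close>

lemma pushforward_density_nonneg:
  fixes q :: "'g \<Rightarrow> real"
  assumes q: "integrable \<mu> q" and q0: "\<And>x. 0 \<le> q x"
  shows "\<exists>m. integrable \<nu> m \<and> (\<forall>w :: 'h \<Rightarrow> complex. w \<in> borel_measurable \<nu> \<longrightarrow>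
    (LINT y|\<nu>. complex_of_real (m y) * w y) = (LINT x|\<mu>. complex_of_real (q x) * w (\<theta> x)))"
proof -
  have [measurable]: "q \<in> borel_measurable \<mu>" using q by measurable
  have t [measurable]: "\<theta> \<in> measurable \<mu> \<nu>" by measurable
  define P where "P = distr (density \<mu> q) \<nu> \<theta>"
  have t' [measurable]: "\<theta> \<in> measurable (density \<mu> q) \<nu>" by simp
  have "absolutely_continuous \<nu> P"
    unfolding absolutely_continuous_def
  proof
    fix A assume A: "A \<in> null_sets \<nu>"
    then have [measurable]: "A \<in> sets \<nu>" by auto
    have "A \<in> null_sets (distr \<mu> \<nu> \<theta>)" using ac A by (auto simp: absolutely_continuous_def)
    then have "\<theta> -` A \<inter> space \<mu> \<in> null_sets \<mu>" by (simp add: null_sets_distr_iff)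
    then have "AE x in \<mu>. x \<notin> \<theta> -` A \<inter> space \<mu>" by (rule AE_not_in)
    then have "(\<integral>\<^sup>+x. ennreal (q x) * indicator (\<theta> -` A \<inter> space \<mu>) x \<partial>\<mu>) = 0"
      by (subst nn_integral_0_iff_AE) (auto elim!: eventually_mono)
    then have "emeasure (density \<mu> q) (\<theta> -` A \<inter> space \<mu>) = 0"
      by (subst emeasure_density) measurable
    then show "A \<in> null_sets P"
      unfolding P_def by (simp add: null_sets_def emeasure_distr)
  qed
  moreover have "sets P = sets \<nu>" by (simp add: P_def)
  ultimately obtain r where r [measurable]: "r \<in> borel_measurable \<nu>" and rP: "density \<nu> r = P"
    using H.Radon_Nikodym by blast
  have "(\<integral>\<^sup>+y. r y \<partial>\<nu>) = emeasure P (space \<nu>)"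
    unfolding rP[symmetric] by (subst emeasure_density) (auto intro!: nn_integral_cong)
  also have "\<dots> = (\<integral>\<^sup>+x. ennreal (q x) \<partial>\<mu>)"
    unfolding P_def by (subst emeasure_distr) (auto simp: emeasure_density intro!: nn_integral_cong)
  also have "\<dots> < \<infinity>"
    using q q0 by (simp add: nn_integral_eq_integral)
  finally have fin: "(\<integral>\<^sup>+y. r y \<partial>\<nu>) < \<infinity>" .
  then have "(\<integral>\<^sup>+y. r y \<partial>\<nu>) \<noteq> \<infinity>" by simp
  then have "AE y in \<nu>. r y \<noteq> \<infinity>" by (intro nn_integral_PInf_AE) measurable
  then have rr: "AE y in \<nu>. r y = ennreal (enn2real (r y))"
    by eventually_elim (simp add: less_top)
  define m where "m y = enn2real (r y)" for y
  have m [measurable]: "m \<in> borel_measurable \<nu>" unfolding m_def by measurable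
  have "density \<nu> (\<lambda>y. ennreal (m y)) = density \<nu> r"
    using rr by (intro density_cong) (auto simp: m_def)
  then have mP: "density \<nu> (\<lambda>y. ennreal (m y)) = P" by (simp add: rP)
  have "(\<integral>\<^sup>+y. ennreal (norm (m y)) \<partial>\<nu>) = (\<integral>\<^sup>+y. r y \<partial>\<nu>)"
    using rr by (intro nn_integral_cong_AE) (auto simp: m_def)
  then have mint: "integrable \<nu> m"
    using fin by (intro integrableI_bounded m) simp
  have "(LINT y|\<nu>. complex_of_real (m y) * w y) = (LINT x|\<mu>. complex_of_real (q x) * w (\<theta> x))"
    if [measurable]: "w \<in> borel_measurable \<nu>" for w :: "'h \<Rightarrow> complex"
  proof -
    have "(LINT y|\<nu>. complex_of_real (m y) * w y) = integral\<^sup>L P w"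
      unfolding mP[symmetric] by (subst integral_density) (auto simp: m_def scaleR_conv_of_real)
    also have "\<dots> = (LINT x|density \<mu> q. w (\<theta> x))"
      unfolding P_def by (rule integral_distr) measurable
    also have "\<dots> = (LINT x|\<mu>. complex_of_real (q x) * w (\<theta> x))"
      using q0 by (subst integral_density) (auto simp: scaleR_conv_of_real)
    finally show ?thesis .
  qed
  then show ?thesis using mint by blast
qed

text \<open>The nonnegative case is applied to the positive and negative parts of the real and
  imaginary parts of q. Boundedness of the test functions makes all integrals converge, so that they
  can be combined linearly.\<close>

lemma pushforward_density:
  fixes q :: "'g \<Rightarrow> complex"
  assumes q: "integrable \<mu> q"
  obtains m where "integrable \<nu> m"
    "\<And>w B. w \<in> borel_measurable \<nu> \<Longrightarrow> (\<And>y. cmod (w y) \<le> B) \<Longrightarrow>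
      (LINT y|\<nu>. m y * w y) = (LINT x|\<mu>. q x * w (\<theta> x))"
proof -
  \<comment> \<open>Integrability of both functions is part of the relation so that it is closed
    under linear combinations, as \<open>lin\<close> shows.\<close>
  define is_push where "is_push q m \<longleftrightarrow> integrable \<mu> q \<and> integrable \<nu> m \<and>
    (\<forall>w B. w \<in> borel_measurable \<nu> \<longrightarrow> (\<forall>y. cmod (w y) \<le> B) \<longrightarrow>
      (LINT y|\<nu>. m y * w y) = (LINT x|\<mu>. q x * w (\<theta> x)))"
    for q :: "'g \<Rightarrow> complex" and m :: "'h \<Rightarrow> complex"
  have nonneg: "\<exists>m. is_push (\<lambda>x. complex_of_real (q x)) m"
    if q: "integrable \<mu> q" "\<And>x. 0 \<le> q x" for q :: "'g \<Rightarrow> real"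
  proof -
    obtain m where "integrable \<nu> m" "\<forall>w :: 'h \<Rightarrow> complex. w \<in> borel_measurable \<nu> \<longrightarrow>
        (LINT y|\<nu>. complex_of_real (m y) * w y) = (LINT x|\<mu>. complex_of_real (q x) * w (\<theta> x))"
      using pushforward_density_nonneg[OF q] by blast
    then have "is_push (\<lambda>x. complex_of_real (q x)) (\<lambda>y. complex_of_real (m y))"
      using q(1) unfolding is_push_def by simp
    then show ?thesis by blast
  qed
  have lin: "is_push (\<lambda>x. q x + c * q' x) (\<lambda>y. m y + c * m' y)"
    if qm: "is_push q m" and qm': "is_push q' m'" for q m q' m' c
    unfolding is_push_def
  proof (intro conjI allI impI)
    show "integrable \<mu> (\<lambda>x. q x + c * q' x)" "integrable \<nu> (\<lambda>y. m y + c * m' y)"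
      using qm qm' by (auto simp: is_push_def)
    fix w :: "'h \<Rightarrow> complex" and B assume w: "w \<in> borel_measurable \<nu>" and B: "\<forall>y. cmod (w y) \<le> B"
    have wt: "(\<lambda>x. w (\<theta> x)) \<in> borel_measurable \<mu>"
      using H.measurable_borel[OF w] by measurable
    have 1: "integrable \<nu> (\<lambda>y. m y * w y)" "integrable \<nu> (\<lambda>y. m' y * w y)"
      by (rule H.integrable_mult_bounded[OF _ w, of _ B]; use qm qm' B in \<open>simp add: is_push_def\<close>)+
    have 2: "integrable \<mu> (\<lambda>x. q x * w (\<theta> x))" "integrable \<mu> (\<lambda>x. q' x * w (\<theta> x))"
      by (rule G.integrable_mult_bounded[OF _ wt, of _ B]; use qm qm' B in \<open>simp add: is_push_def\<close>)+
    have push: "(LINT y|\<nu>. m y * w y) = (LINT x|\<mu>. q x * w (\<theta> x))"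
      using qm w B unfolding is_push_def by blast
    have push': "(LINT y|\<nu>. m' y * w y) = (LINT x|\<mu>. q' x * w (\<theta> x))"
      using qm' w B unfolding is_push_def by blast
    have "(LINT y|\<nu>. (m y + c * m' y) * w y) = (LINT y|\<nu>. m y * w y) + c * (LINT y|\<nu>. m' y * w y)"
      using 1 by (simp add: distrib_right mult.assoc)
    also have "\<dots> = (LINT x|\<mu>. q x * w (\<theta> x)) + c * (LINT x|\<mu>. q' x * w (\<theta> x))"
      unfolding push push' ..
    also have "\<dots> = (LINT x|\<mu>. (q x + c * q' x) * w (\<theta> x))"
      using 2 by (simp add: distrib_right mult.assoc)
    finally show "(LINT y|\<nu>. (m y + c * m' y) * w y) = (LINT x|\<mu>. (q x + c * q' x) * w (\<theta> x))" .
  qed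
  have ex: "\<exists>m. is_push (\<lambda>x. complex_of_real (max 0 (p x))) m" if "integrable \<mu> p" for p :: "'g \<Rightarrow> real"
    by (rule nonneg) (use that in auto)
  have qi: "integrable \<mu> (\<lambda>x. Re (q x))" "integrable \<mu> (\<lambda>x. Im (q x))"
      "integrable \<mu> (\<lambda>x. - Re (q x))" "integrable \<mu> (\<lambda>x. - Im (q x))"
    using q by auto
  obtain m1 m2 m3 m4 where
    "is_push (\<lambda>x. complex_of_real (max 0 (Re (q x)))) m1"
    "is_push (\<lambda>x. complex_of_real (max 0 (Im (q x)))) m2"
    "is_push (\<lambda>x. complex_of_real (max 0 (- Re (q x)))) m3"
    "is_push (\<lambda>x. complex_of_real (max 0 (- Im (q x)))) m4"
    using ex[OF qi(1)] ex[OF qi(2)] ex[OF qi(3)] ex[OF qi(4)] by blast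
  \<comment> \<open>The coefficients -1, i and -i reassemble q from its four parts.\<close>
  from lin[OF lin[OF lin[OF this(1,3), of "-1"] this(2), of \<i>] this(4), of "-\<i>"]
  obtain m where m: "is_push (\<lambda>x. complex_of_real (max 0 (Re (q x))) + (-1) * complex_of_real (max 0 (- Re (q x)))
      + \<i> * complex_of_real (max 0 (Im (q x))) + (-\<i>) * complex_of_real (max 0 (- Im (q x)))) m"
    by blast
  have "complex_of_real (max 0 (Re z)) + (-1) * complex_of_real (max 0 (- Re z))
      + \<i> * complex_of_real (max 0 (Im z)) + (-\<i>) * complex_of_real (max 0 (- Im z)) = z" for z
    by (simp add: complex_eq_iff max_def)
  then have "is_push q m" using m by simp
  then show thesis
    unfolding is_push_def by (intro that) auto
qed

text \<open>\<open>F h\<close> is the slice at h of the function f(y) \<phi>(\<theta> y + h) of two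
  variables. By Fubini and left invariance of \<nu> this function has the same norm as the tensor
  product of f and \<phi>. Hence almost every slice is square-integrable and the slice norms are a
  square-integrable function of h.\<close>

lemma twisted_slices:
  assumes f: "f \<in> L2 \<mu>" and \<phi>: "\<phi> \<in> L2 \<nu>"
  defines "F \<equiv> \<lambda>h y. f y * \<phi> (\<theta> y + h)"
  shows "AE h in \<nu>. F h \<in> L2 \<mu>"
    and "(\<lambda>h. complex_of_real (l2norm \<mu> (F h))) \<in> L2 \<nu>"
    and "l2norm \<nu> (\<lambda>h. complex_of_real (l2norm \<mu> (F h))) = l2norm \<mu> f * l2norm \<nu> \<phi>"
proof -
  note [measurable] = G.L2_borel[OF f] H.L2_borel[OF \<phi>]
  define p where "p y h = (cmod (f y))\<^sup>2 * (cmod (\<phi> (\<theta> y + h)))\<^sup>2" for y h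
  have pF: "(cmod (F h y))\<^sup>2 = p y h" for y h
    by (simp add: F_def p_def norm_mult power_mult_distrib)
  have [measurable]: "case_prod p \<in> borel_measurable (\<mu> \<Otimes>\<^sub>M \<nu>)"
    unfolding p_def by measurable
  have p1: "integrable \<nu> (p y)" for y
    unfolding p_def by (intro integrable_mult_right H.integrable_left_transl L2_integrable \<phi>)
  have p2: "(LINT h|\<nu>. p y h) = (cmod (f y))\<^sup>2 * (l2norm \<nu> \<phi>)\<^sup>2" for y
  proof -
    have "(LINT h|\<nu>. p y h) = (cmod (f y))\<^sup>2 * (LINT h|\<nu>. (cmod (\<phi> (\<theta> y + h)))\<^sup>2)"
      unfolding p_def by simp
    also have "(LINT h|\<nu>. (cmod (\<phi> (\<theta> y + h)))\<^sup>2) = (l2norm \<nu> \<phi>)\<^sup>2"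
      unfolding l2norm_power2 by (rule H.integral_left_transl[where f = "\<lambda>h. (cmod (\<phi> h))\<^sup>2"]) measurable
    finally show ?thesis .
  qed
  have p0: "0 \<le> p y h" for y h by (simp add: p_def)
  have pint: "integrable (\<mu> \<Otimes>\<^sub>M \<nu>) (case_prod p)"
  proof (rule GH.Fubini_integrable)
    show "integrable \<mu> (\<lambda>x. LINT y|\<nu>. norm (case_prod p (x, y)))"
      using L2_integrable[OF f] by (simp add: p0 p2)
    show "AE x in \<mu>. integrable \<nu> (\<lambda>y. case_prod p (x, y))"
      using p1 by simp
  qed measurable
  have Fm: "F h \<in> borel_measurable \<mu>" for h
    unfolding F_def by measurable
  show "AE h in \<nu>. F h \<in> L2 \<mu>"
    using GH.AE_integrable_snd[OF pint] by eventually_elim (simp add: L2_def Fm pF)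
  have n: "(l2norm \<mu> (F h))\<^sup>2 = (LINT y|\<mu>. p y h)" for h
    by (simp add: l2norm_power2 pF)
  have "(\<lambda>h. complex_of_real (l2norm \<mu> (F h))) \<in> borel_measurable \<nu>"
    unfolding l2norm_def F_def by measurable
  then show "(\<lambda>h. complex_of_real (l2norm \<mu> (F h))) \<in> L2 \<nu>"
    using GH.integrable_snd[OF pint] by (simp add: L2_def n)
  have "(l2norm \<nu> (\<lambda>h. complex_of_real (l2norm \<mu> (F h))))\<^sup>2 = (LINT h|\<nu>. LINT y|\<mu>. p y h)"
    by (simp add: l2norm_power2[of \<nu>] n)
  also have "\<dots> = (LINT y|\<mu>. LINT h|\<nu>. p y h)"
    by (rule GH.Fubini_integral[OF pint])
  also have "\<dots> = (l2norm \<mu> f * l2norm \<nu> \<phi>)\<^sup>2"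
    by (simp add: p2 power_mult_distrib l2norm_power2[of \<mu>])
  finally show "l2norm \<nu> (\<lambda>h. complex_of_real (l2norm \<mu> (F h))) = l2norm \<mu> f * l2norm \<nu> \<phi>"
    by (rule power2_eq_imp_eq) simp_all
qed

text \<open>Fell's absorption principle: the unitary \<open>F \<mapsto> ((y, h) \<mapsto> F (y, \<theta> y + h))\<close> turns
  \<open>\<lambda> \<otimes> (\<lambda> \<circ> \<theta>)\<close> into \<open>\<lambda> \<otimes> 1\<close>.\<close>

lemma coef_mult_coef:
  assumes f: "f \<in> L2 \<mu>" and g: "g \<in> L2 \<mu>" and \<phi>: "\<phi> \<in> L2 \<nu>" and \<psi>: "\<psi> \<in> L2 \<nu>"
  shows "coef \<mu> f g x * coef \<nu> \<phi> \<psi> (\<theta> x)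
    = (LINT h|\<nu>. coef \<mu> (\<lambda>y. f y * \<phi> (\<theta> y + h)) (\<lambda>y. g y * \<psi> (\<theta> y + h)) x)"
proof -
  note [measurable] = G.L2_borel[OF f] G.L2_borel[OF g] H.L2_borel[OF \<phi>] H.L2_borel[OF \<psi>]
  define s where "s y = left_transl x f y * cnj (g y)" for y
  define t where "t z = left_transl (\<theta> x) \<phi> z * cnj (\<psi> z)" for z
  have [measurable]: "s \<in> borel_measurable borel" "t \<in> borel_measurable borel"
    unfolding s_def t_def left_transl_def by measurable
  have s: "integrable \<mu> s" unfolding s_def by (intro L2_inner_integrable G.L2_left_transl f g)
  have t: "integrable \<nu> t" unfolding t_def by (intro L2_inner_integrable H.L2_left_transl \<phi> \<psi>)
  \<comment> \<open>Left invariance makes the integral over h independent of y, so the double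
    integral factors into the two coefficients.\<close>
  have t1: "(LINT h|\<nu>. t (\<theta> y + h)) = integral\<^sup>L \<nu> t" for y
    by (rule H.integral_left_transl) measurable
  have t2: "(LINT h|\<nu>. cmod (t (\<theta> y + h))) = (LINT h|\<nu>. cmod (t h))" for y
    by (rule H.integral_left_transl[where f = "\<lambda>h. cmod (t h)"]) measurable
  have int: "integrable (\<mu> \<Otimes>\<^sub>M \<nu>) (\<lambda>(y, h). s y * t (\<theta> y + h))"
  proof (rule GH.Fubini_integrable)
    show "integrable \<mu> (\<lambda>y. LINT h|\<nu>. norm (case (y, h) of (y, h) \<Rightarrow> s y * t (\<theta> y + h)))"
      using s by (simp add: norm_mult t2)
    show "AE y in \<mu>. integrable \<nu> (\<lambda>h. case (y, h) of (y, h) \<Rightarrow> s y * t (\<theta> y + h))"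
      using H.integrable_left_transl[OF t] by simp
  qed measurable
  \<comment> \<open>Here \<theta>(-x + y) + h = -\<theta>(x) + (\<theta>(y) + h): the translation by
    \<theta>(x) in the second factor is absorbed into the argument of \<open>t\<close>.\<close>
  have st: "f (- x + y) * \<phi> (\<theta> (- x + y) + h) * cnj (g y * \<psi> (\<theta> y + h)) = s y * t (\<theta> y + h)" for y h
    by (simp add: s_def t_def left_transl_def hom hom_uminus add.assoc)
  have "(LINT h|\<nu>. coef \<mu> (\<lambda>y. f y * \<phi> (\<theta> y + h)) (\<lambda>y. g y * \<psi> (\<theta> y + h)) x)
      = (LINT h|\<nu>. LINT y|\<mu>. s y * t (\<theta> y + h))"
    unfolding coef_def l2inner_def by (simp only: left_transl_def[of x "\<lambda>y. f y * \<phi> (\<theta> y + _)"] st)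
  also have "\<dots> = (LINT y|\<mu>. LINT h|\<nu>. s y * t (\<theta> y + h))"
    by (rule GH.Fubini_integral[OF int])
  also have "\<dots> = (LINT y|\<mu>. s y * integral\<^sup>L \<nu> t)"
    by (simp add: t1)
  also have "\<dots> = integral\<^sup>L \<mu> s * integral\<^sup>L \<nu> t"
    by simp
  also have "\<dots> = coef \<mu> f g x * coef \<nu> \<phi> \<psi> (\<theta> x)"
    unfolding coef_def l2inner_def s_def t_def ..
  finally show ?thesis by (rule sym)
qed

text \<open>The hypothesis \<open>kb\<close> says that convolution by k has norm at most C. After
  \<open>coef_mult_coef\<close> and an exchange of integrals it applies to each slice, and
  Cauchy-Schwarz in h sums the slice norms. The bound thus depends on the operator norm of the
  convolution and not on the L1 norm of k, as needed for passing to limits in the reduced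
  algebra.\<close>

lemma integral_coef_mult_coef_bound:
  assumes k: "integrable \<mu> k" and C: "0 \<le> C"
    and kb: "\<And>F G. F \<in> L2 \<mu> \<Longrightarrow> G \<in> L2 \<mu> \<Longrightarrow>
      cmod (LINT x|\<mu>. k x * coef \<mu> F G x) \<le> C * (l2norm \<mu> F * l2norm \<mu> G)"
    and f: "f \<in> L2 \<mu>" and g: "g \<in> L2 \<mu>" and \<phi>: "\<phi> \<in> L2 \<nu>" and \<psi>: "\<psi> \<in> L2 \<nu>"
  shows "cmod (LINT x|\<mu>. k x * (coef \<mu> f g x * coef \<nu> \<phi> \<psi> (\<theta> x)))
    \<le> C * (l2norm \<mu> f * l2norm \<mu> g * (l2norm \<nu> \<phi> * l2norm \<nu> \<psi>))"
proof -
  note [measurable] = G.L2_borel[OF f] G.L2_borel[OF g] H.L2_borel[OF \<phi>] H.L2_borel[OF \<psi>]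
    G.measurable_borel[OF borel_measurable_integrable[OF k]]
  define F where "F h y = f y * \<phi> (\<theta> y + h)" for h y
  define K where "K h y = g y * \<psi> (\<theta> y + h)" for h y
  note F = twisted_slices[OF f \<phi>, folded F_def] and K = twisted_slices[OF g \<psi>, folded K_def]
  define N where "N h = l2norm \<mu> (F h) * l2norm \<mu> (K h)" for h
  have Nint: "integrable \<nu> N" and Nle: "integral\<^sup>L \<nu> N \<le> l2norm \<mu> f * l2norm \<mu> g * (l2norm \<nu> \<phi> * l2norm \<nu> \<psi>)"
    using L2_mult_integrable[OF F(2) K(2)] L2_Cauchy_Schwarz[OF F(2) K(2)]
    by (simp_all add: N_def[abs_def] F(3) K(3) mult_ac)
  define D where "D x h = coef \<mu> (F h) (K h) x" for x h
  have [measurable]: "case_prod D \<in> borel_measurable (\<mu> \<Otimes>\<^sub>M \<nu>)"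
    unfolding D_def coef_def l2inner_def left_transl_def F_def K_def by measurable
  have Dm: "D x \<in> borel_measurable \<nu>" for x by measurable
  \<comment> \<open>Slices are square-integrable only for almost every h, so \<open>kb\<close> and
    the coefficient bound are available only almost everywhere in h.\<close>
  have FK: "AE h in \<nu>. F h \<in> L2 \<mu> \<and> K h \<in> L2 \<mu>"
    using F(1) K(1) by eventually_elim simp
  have DN: "AE h in \<nu>. cmod (D x h) \<le> N h" for x
    using FK by eventually_elim (simp add: D_def N_def G.coef_bound)
  have Dint: "integrable \<nu> (D x)" for x
    by (rule Bochner_Integration.integrable_bound[OF Nint Dm])
       (use DN[of x] in \<open>eventually_elim, simp\<close>)
  have kD: "integrable (\<mu> \<Otimes>\<^sub>M \<nu>) (\<lambda>(x, h). k x * D x h)"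
  proof (rule GH.Fubini_integrable)
    show "integrable \<mu> (\<lambda>x. LINT h|\<nu>. norm (case (x, h) of (x, h) \<Rightarrow> k x * D x h))"
    proof (rule Bochner_Integration.integrable_bound)
      show "integrable \<mu> (\<lambda>x. cmod (k x) * integral\<^sup>L \<nu> N)" using k by simp
      have "(LINT h|\<nu>. cmod (D x h)) \<le> integral\<^sup>L \<nu> N" for x
        by (intro integral_mono_AE integrable_norm Dint Nint DN)
      then have "norm (LINT h|\<nu>. cmod (k x * D x h)) \<le> norm (cmod (k x) * integral\<^sup>L \<nu> N)" for x
        by (simp add: norm_mult abs_mult mult_left_mono order_trans[OF _ abs_ge_self])
      then show "AE x in \<mu>. norm (LINT h|\<nu>. norm (case (x, h) of (x, h) \<Rightarrow> k x * D x h))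
          \<le> norm (cmod (k x) * integral\<^sup>L \<nu> N)" by simp
    qed measurable
    show "AE x in \<mu>. integrable \<nu> (\<lambda>h. case (x, h) of (x, h) \<Rightarrow> k x * D x h)"
      using Dint by simp
  qed measurable
  have "(LINT x|\<mu>. k x * (coef \<mu> f g x * coef \<nu> \<phi> \<psi> (\<theta> x))) = (LINT x|\<mu>. LINT h|\<nu>. k x * D x h)"
    by (simp add: coef_mult_coef[OF f g \<phi> \<psi>] D_def F_def[abs_def] K_def[abs_def])
  also have "\<dots> = (LINT h|\<nu>. LINT x|\<mu>. k x * D x h)"
    by (rule GH.Fubini_integral[OF kD, symmetric])
  also have "cmod \<dots> \<le> (LINT h|\<nu>. cmod (LINT x|\<mu>. k x * D x h))"
    by (rule integral_norm_bound)
  also have "\<dots> \<le> (LINT h|\<nu>. C * N h)"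
  proof (rule integral_mono_AE)
    show "integrable \<nu> (\<lambda>h. cmod (LINT x|\<mu>. k x * D x h))"
      by (rule integrable_norm[OF GH.integrable_snd[OF kD]])
    show "integrable \<nu> (\<lambda>h. C * N h)" using Nint by simp
    show "AE h in \<nu>. cmod (LINT x|\<mu>. k x * D x h) \<le> C * N h"
      using FK by eventually_elim (simp add: D_def N_def kb)
  qed
  also have "\<dots> \<le> C * (l2norm \<mu> f * l2norm \<mu> g * (l2norm \<nu> \<phi> * l2norm \<nu> \<psi>))"
    using mult_left_mono[OF Nle C] by simp
  finally show ?thesis .
qed

text \<open>\<open>S\<close> is the image of \<open>u \<cdot> T\<close>, where \<open>u = coef f g\<close>, under the adjoint of \<open>v \<mapsto> v \<circ> \<theta>\<close>.\<close>

lemma transferred_operator: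
  assumes T: "T \<in> Cr \<mu>" and f: "f \<in> L2 \<mu>" and g: "g \<in> L2 \<mu>"
  obtains S where "S \<in> Cr \<nu>"
    "\<And>v a b a' b'. A_rep \<nu> v a b \<Longrightarrow> A_rep \<mu> (\<lambda>x. coef \<mu> f g x * v (\<theta> x)) a' b' \<Longrightarrow>
      (\<Sum>n. l2inner \<nu> (S (a n)) (b n)) = (\<Sum>n. l2inner \<mu> (T (a' n)) (b' n))"
proof -
  define u where "u = coef \<mu> f g"
  have um: "u \<in> borel_measurable \<mu>" and ub: "\<And>x. cmod (u x) \<le> l2norm \<mu> f * l2norm \<mu> g"
    unfolding u_def by (intro G.coef_measurable G.coef_bound f g)+
  \<comment> \<open>The rate 2^(-n) for the approximation of \<open>T\<close> is inherited by the
    operators on the target group and matches the geometric rate in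
    \<open>bdd_op_limit\<close>.\<close>
  have "\<exists>k. integrable \<mu> k \<and> (\<forall>F\<in>L2 \<mu>. \<forall>G\<in>L2 \<mu>.
      cmod (l2inner \<mu> (T F) G - (LINT x|\<mu>. k x * coef \<mu> F G x)) \<le> (1/2)^n * (l2norm \<mu> F * l2norm \<mu> G))" for n
    by (rule G.Cr_approx[OF T, of "(1/2)^n"]) auto
  then obtain k where k: "\<And>n. integrable \<mu> (k n)" and Tk: "\<And>n F G. F \<in> L2 \<mu> \<Longrightarrow> G \<in> L2 \<mu> \<Longrightarrow>
      cmod (l2inner \<mu> (T F) G - (LINT x|\<mu>. k n x * coef \<mu> F G x)) \<le> (1/2)^n * (l2norm \<mu> F * l2norm \<mu> G)"
    by metis
  have ku: "integrable \<mu> (\<lambda>x. k n x * u x)" for n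
    by (rule G.integrable_mult_bounded[OF k um ub])
  have "\<exists>m. integrable \<nu> m \<and> (\<forall>w B. w \<in> borel_measurable \<nu> \<longrightarrow> (\<forall>y. cmod (w y) \<le> B) \<longrightarrow>
      (LINT y|\<nu>. m y * w y) = (LINT x|\<mu>. k n x * u x * w (\<theta> x)))" for n
    by (rule pushforward_density[OF ku[of n]]) blast
  then obtain m where m: "\<And>n. integrable \<nu> (m n)"
    and mw: "\<And>n w B. w \<in> borel_measurable \<nu> \<Longrightarrow> (\<forall>y. cmod (w y) \<le> B) \<Longrightarrow>
      (LINT y|\<nu>. m n y * w y) = (LINT x|\<mu>. k n x * u x * w (\<theta> x))"
    by metis
  \<comment> \<open>The factor 2 arises from comparing two approximants through \<open>T\<close>;
    the norms of f and g come from the multiplication by \<open>u\<close>.\<close>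
  define c where "c = 2 * (l2norm \<mu> f * l2norm \<mu> g)"
  have c: "0 \<le> c" by (simp add: c_def)
  have mcoef: "(LINT y|\<nu>. m n y * coef \<nu> \<phi> \<psi> y) = (LINT x|\<mu>. k n x * (u x * coef \<nu> \<phi> \<psi> (\<theta> x)))"
    if "\<phi> \<in> L2 \<nu>" "\<psi> \<in> L2 \<nu>" for n \<phi> \<psi>
    using mw[OF H.coef_measurable[OF that], of "l2norm \<nu> \<phi> * l2norm \<nu> \<psi>" n] H.coef_bound[OF that]
    by (simp add: mult.assoc)
  define A where "A n = conv_op \<nu> (m n)" for n
  have A: "bdd_op \<nu> (A n)" for n
    unfolding A_def by (rule H.conv_op_bdd[OF m])
  have Adiff: "l2norm \<nu> (\<lambda>x. A j \<phi> x - A i \<phi> x) \<le> c * (1/2)^i * l2norm \<nu> \<phi>"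
    if ij: "i \<le> j" and \<phi>: "\<phi> \<in> L2 \<nu>" for i j \<phi>
  proof (rule l2norm_le_of_inner_bound)
    fix \<psi> assume \<psi>: "\<psi> \<in> L2 \<nu>"
    have d: "integrable \<mu> (\<lambda>x. k j x - k i x)" using k by simp
    have db: "cmod (LINT x|\<mu>. (k j x - k i x) * coef \<mu> F G x) \<le> 2 * (1/2)^i * (l2norm \<mu> F * l2norm \<mu> G)"
      if F: "F \<in> L2 \<mu>" and G: "G \<in> L2 \<mu>" for F G
    proof -
      have "(LINT x|\<mu>. (k j x - k i x) * coef \<mu> F G x)
          = (LINT x|\<mu>. k j x * coef \<mu> F G x) - (LINT x|\<mu>. k i x * coef \<mu> F G x)"
        using G.integrable_mult_coef[OF k F G] by (simp add: left_diff_distrib)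
      also have "\<dots> = (l2inner \<mu> (T F) G - (LINT x|\<mu>. k i x * coef \<mu> F G x))
          - (l2inner \<mu> (T F) G - (LINT x|\<mu>. k j x * coef \<mu> F G x))"
        by simp
      also have "cmod \<dots> \<le> (1/2)^i * (l2norm \<mu> F * l2norm \<mu> G) + (1/2)^j * (l2norm \<mu> F * l2norm \<mu> G)"
        by (rule order_trans[OF norm_triangle_ineq4 add_mono[OF Tk[OF F G] Tk[OF F G]]])
      also have "\<dots> \<le> (1/2)^i * (l2norm \<mu> F * l2norm \<mu> G) + (1/2)^i * (l2norm \<mu> F * l2norm \<mu> G)"
        using ij by (intro add_left_mono mult_right_mono power_decreasing) auto
      finally show ?thesis by (simp only: mult.assoc mult_2 distrib_right)
    qed
    have ti: "integrable \<mu> (\<lambda>x. k n x * (u x * coef \<nu> \<phi> \<psi> (\<theta> x)))" for n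
    proof -
      have "(\<lambda>x. coef \<nu> \<phi> \<psi> (\<theta> x)) \<in> borel_measurable \<mu>"
        using H.measurable_borel[OF H.coef_measurable[OF \<phi> \<psi>]] by measurable
      from G.integrable_mult_bounded[OF ku this H.coef_bound[OF \<phi> \<psi>]]
      show ?thesis by (simp add: mult.assoc)
    qed
    have "l2inner \<nu> (\<lambda>x. A j \<phi> x - A i \<phi> x) \<psi>
        = (LINT x|\<mu>. k j x * (u x * coef \<nu> \<phi> \<psi> (\<theta> x))) - (LINT x|\<mu>. k i x * (u x * coef \<nu> \<phi> \<psi> (\<theta> x)))"
      unfolding A_def
      by (simp add: l2inner_diff_left[OF H.conv_op_L2[OF m \<phi>] H.conv_op_L2[OF m \<phi>] \<psi>]
          H.l2inner_conv_op[OF m \<phi> \<psi>] mcoef[OF \<phi> \<psi>])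
    also have "\<dots> = (LINT x|\<mu>. (k j x - k i x) * (u x * coef \<nu> \<phi> \<psi> (\<theta> x)))"
      using ti by (simp add: left_diff_distrib)
    also have "cmod \<dots> \<le> 2 * (1/2)^i * (l2norm \<mu> f * l2norm \<mu> g * (l2norm \<nu> \<phi> * l2norm \<nu> \<psi>))"
      unfolding u_def by (rule integral_coef_mult_coef_bound[OF d _ db f g \<phi> \<psi>]) auto
    finally show "cmod (l2inner \<nu> (\<lambda>x. A j \<phi> x - A i \<phi> x) \<psi>) \<le> c * (1/2)^i * l2norm \<nu> \<phi> * l2norm \<nu> \<psi>"
      by (simp add: c_def mult_ac)
  next
    show "(\<lambda>x. A j \<phi> x - A i \<phi> x) \<in> L2 \<nu>" by (intro L2_diff bdd_op_L2[OF A] \<phi>)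
    show "0 \<le> c * (1/2)^i * l2norm \<nu> \<phi>" using c by simp
  qed
  obtain S where S: "bdd_op \<nu> S"
    and SA: "\<And>n \<phi>. \<phi> \<in> L2 \<nu> \<Longrightarrow> l2norm \<nu> (\<lambda>x. S \<phi> x - A n \<phi> x) \<le> c * (1/2)^n * l2norm \<nu> \<phi>"
    by (rule bdd_op_limit[OF A c Adiff]) blast+
  have Sm: "cmod (l2inner \<nu> (S \<phi>) \<psi> - (LINT y|\<nu>. m n y * coef \<nu> \<phi> \<psi> y))
      \<le> c * (1/2)^n * (l2norm \<nu> \<phi> * l2norm \<nu> \<psi>)" if \<phi>: "\<phi> \<in> L2 \<nu>" and \<psi>: "\<psi> \<in> L2 \<nu>" for n \<phi> \<psi>
  proof -
    note L = bdd_op_L2[OF S \<phi>] bdd_op_L2[OF A \<phi>]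
    have "l2inner \<nu> (S \<phi>) \<psi> - (LINT y|\<nu>. m n y * coef \<nu> \<phi> \<psi> y) = l2inner \<nu> (\<lambda>x. S \<phi> x - A n \<phi> x) \<psi>"
      by (simp add: l2inner_diff_left[OF L \<psi>]) (simp add: A_def H.l2inner_conv_op[OF m \<phi> \<psi>])
    also have "cmod \<dots> \<le> l2norm \<nu> (\<lambda>x. S \<phi> x - A n \<phi> x) * l2norm \<nu> \<psi>"
      by (intro l2inner_bound L2_diff L \<psi>)
    also have "\<dots> \<le> c * (1/2)^n * l2norm \<nu> \<phi> * l2norm \<nu> \<psi>"
      by (intro mult_right_mono SA \<phi>) simp
    finally show ?thesis by (simp add: mult.assoc)
  qed
  show thesis
  proof (rule that)
    have "\<exists>h. integrable \<nu> h \<and> op_norm \<nu> (\<lambda>f y. S f y - conv_op \<nu> h f y) < e" if e: "0 < e" for e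
    proof -
      have "(\<lambda>n. c * (1/2)^n) \<longlonglongrightarrow> c * 0"
        by (intro tendsto_mult tendsto_const LIMSEQ_power_zero) simp
      then have "eventually (\<lambda>n. c * (1/2)^n < e) sequentially"
        using e by (intro order_tendstoD) auto
      then obtain n where n: "c * (1/2)^n < e"
        by (meson eventually_happens trivial_limit_sequentially)
      have "op_norm \<nu> (\<lambda>f y. S f y - A n f y) \<le> c * (1/2)^n"
        using c by (intro op_norm_leI SA) auto
      then show ?thesis using n m[of n] unfolding A_def by (meson le_less_trans)
    qed
    then show "S \<in> Cr \<nu>" using S by (simp add: Cr_def)
    fix v a b a' b'
    assume v: "A_rep \<nu> v a b" and uv: "A_rep \<mu> (\<lambda>x. coef \<mu> f g x * v (\<theta> x)) a' b'"
    \<comment> \<open>\<open>z n\<close> has two readings: the pairing of \<open>m n\<close> with v,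
      and, since v is bounded and \<open>m n\<close> is a push-forward density, the pairing of
      \<open>k n\<close> with the product of u and v \<circ> \<theta>. The first converges to the
      pairing with \<open>S\<close>, the second to the pairing with \<open>T\<close>.\<close>
    define z where "z n = (LINT y|\<nu>. m n y * v y)" for n
    have z: "z n = (LINT x|\<mu>. k n x * (coef \<mu> f g x * v (\<theta> x)))" for n
      unfolding z_def u_def[symmetric]
      using mw[OF H.A_rep_measurable[OF v] allI[OF H.A_rep_bounded[OF v]], of n] by (simp only: mult.assoc)
    have "z \<longlonglongrightarrow> (\<Sum>n. l2inner \<nu> (S (a n)) (b n))"
    proof (rule tendsto_of_geometric_bound)
      fix n
      show "cmod ((\<Sum>n. l2inner \<nu> (S (a n)) (b n)) - z n)
          \<le> (c * (\<Sum>n. l2norm \<nu> (a n) * l2norm \<nu> (b n))) * (1/2)^n"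
        using H.pairing_approx[OF v m Sm, of n] unfolding z_def by (simp only: mult_ac)
    qed
    moreover have "z \<longlonglongrightarrow> (\<Sum>n. l2inner \<mu> (T (a' n)) (b' n))"
    proof (rule tendsto_of_geometric_bound)
      fix n
      show "cmod ((\<Sum>n. l2inner \<mu> (T (a' n)) (b' n)) - z n)
          \<le> (\<Sum>n. l2norm \<mu> (a' n) * l2norm \<mu> (b' n)) * (1/2)^n"
        using G.pairing_approx[OF uv k Tk, of n] unfolding z by (simp only: mult_ac)
    qed
    ultimately show "(\<Sum>n. l2inner \<nu> (S (a n)) (b n)) = (\<Sum>n. l2inner \<mu> (T (a' n)) (b' n))"
      by (rule LIMSEQ_unique)
  qed
qed

section \<open>Transfer of a nonzero annihilating operator\<close>

lemma ideal_of_multiplicity_transfer: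
  assumes mult: "ideal_of_multiplicity \<mu> (rho_star \<mu> \<theta> I)"
  shows "ideal_of_multiplicity \<nu> I"
proof -
  obtain T where T: "T \<in> Cr \<mu>" and nz: "nonzero_op \<mu> T"
    and ann: "\<And>u a b. u \<in> rho_star \<mu> \<theta> I \<Longrightarrow> A_rep \<mu> u a b \<Longrightarrow> (\<Sum>n. l2inner \<mu> (T (a n)) (b n)) = 0"
    using mult unfolding ideal_of_multiplicity_def annihilator_def by blast
  have Tb: "bdd_op \<mu> T" using T by (simp add: Cr_def)
  obtain f g K where f: "f \<in> L2 \<mu>" and g: "g \<in> L2 \<mu>" and K: "compact K"
    and supp: "\<And>x. x \<notin> K \<Longrightarrow> f x = 0" "\<And>x. x \<notin> K \<Longrightarrow> g x = 0" and fg: "l2inner \<mu> (T f) g \<noteq> 0"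
    by (rule G.nonzero_op_compact_support[OF Tb nz]) blast
  define u where "u = coef \<mu> f g"
  note u_rep = G.A_rep_coef[OF f g, folded u_def]
  \<comment> \<open>If no closed ideal contained the image of \<open>I\<close>, the intersection
    defining \<open>rho_star\<close> would be over the empty family and contain every function, in
    particular \<open>u\<close>; then \<open>T\<close> would annihilate \<open>u\<close>, contrary
    to \<open>fg\<close>.\<close>
  have "\<exists>J. closed_ideal \<mu> J \<and> (\<lambda>u. u \<circ> \<theta>) ` I \<subseteq> J"
  proof (rule ccontr)
    assume "\<not> ?thesis"
    then have "u \<in> rho_star \<mu> \<theta> I" unfolding rho_star_def by blast
    then have "l2inner \<mu> (T f) g = 0"
      using ann[OF _ u_rep] by (simp only: G.suminf_l2inner_single)
    then show False using fg by simp
  qed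
  then obtain J where J: "closed_ideal \<mu> J" "(\<lambda>u. u \<circ> \<theta>) ` I \<subseteq> J" by blast
  have u_alg: "u \<in> fourier_alg \<mu>" using u_rep unfolding fourier_alg_def by blast
  \<comment> \<open>The ideal property is applied with the multiplier \<open>u\<close> in the
    Fourier algebra. Stated for every admissible \<open>J\<close>, it gives membership in the
    intersection as well as in the particular ideal found above.\<close>
  have uv: "(\<lambda>x. u x * v (\<theta> x)) \<in> J" if v: "v \<in> I" and J: "closed_ideal \<mu> J" "(\<lambda>u. u \<circ> \<theta>) ` I \<subseteq> J" for v J
  proof -
    have "v \<circ> \<theta> \<in> J" using v J(2) by blast
    then have "(\<lambda>x. u x * (v \<circ> \<theta>) x) \<in> J"
      by (rule closed_ideal_mult[OF J(1) _ u_alg])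
    then show ?thesis by (simp only: o_apply)
  qed
  obtain S where S: "S \<in> Cr \<nu>" and ST: "\<And>v a b a' b'. A_rep \<nu> v a b \<Longrightarrow>
      A_rep \<mu> (\<lambda>x. u x * v (\<theta> x)) a' b' \<Longrightarrow>
      (\<Sum>n. l2inner \<nu> (S (a n)) (b n)) = (\<Sum>n. l2inner \<mu> (T (a' n)) (b' n))"
    unfolding u_def by (rule transferred_operator[OF T f g]) blast
  have "(\<Sum>n. l2inner \<nu> (S (a n)) (b n)) = 0" if v: "v \<in> I" and ab: "A_rep \<nu> v a b" for v a b
  proof -
    \<comment> \<open>A representation of the product is required to evaluate its pairing with
      \<open>T\<close>; it exists because \<open>J\<close> consists of elements of the Fourier
      algebra.\<close>
    have "(\<lambda>x. u x * v (\<theta> x)) \<in> fourier_alg \<mu>"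
      using uv[OF v J] closed_ideal_subset[OF J(1)] by (rule subsetD[rotated])
    then obtain a' b' where ab': "A_rep \<mu> (\<lambda>x. u x * v (\<theta> x)) a' b'"
      unfolding fourier_alg_def by blast
    have "(\<lambda>x. u x * v (\<theta> x)) \<in> rho_star \<mu> \<theta> I"
      unfolding rho_star_def using uv[OF v] by blast
    from ann[OF this ab'] show ?thesis unfolding ST[OF ab ab'] .
  qed
  then have "S \<in> annihilator \<nu> I"
    unfolding annihilator_def using S H.Cr_subset_VN by blast
  moreover have "nonzero_op \<nu> S"
  proof -
    let ?D = "(\<lambda>(a, b). a - b) ` (K \<times> K)"
    have "compact ?D"
      by (rule compact_continuous_image[OF _ compact_Times[OF K K]])
         (auto simp: split_beta intro!: continuous_intros)
    then have "compact (\<theta> ` ?D)"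
      by (rule compact_continuous_image[OF continuous_on_subset[OF cont subset_UNIV]])
    then obtain \<phi> \<psi> where \<phi>: "\<phi> \<in> L2 \<nu>" and \<psi>: "\<psi> \<in> L2 \<nu>"
      and one: "\<And>y. y \<in> \<theta> ` ?D \<Longrightarrow> coef \<nu> \<phi> \<psi> y = 1"
      by (rule H.coef_eq_1_on_compact) blast
    \<comment> \<open>\<open>u\<close> vanishes off the compact set of differences
      \<open>?D\<close>, and the cut-off composed with \<theta> is 1 on it.\<close>
    have u1: "u x * coef \<nu> \<phi> \<psi> (\<theta> x) = u x" for x
    proof (cases "x \<in> ?D")
      case True
      then show ?thesis using one[OF imageI] by simp
    next
      case False
      then have "u x = 0" unfolding u_def using supp by (intro G.coef_eq_0_outside[of K]) auto
      then show ?thesis by simp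
    qed
    \<comment> \<open>The product is \<open>u\<close> itself as a function, so its one-term
      representation by f and g is admissible in \<open>ST\<close> and the pairing with
      \<open>T\<close> is the nonzero number \<langle>T f, g\<rangle>.\<close>
    have "A_rep \<mu> (\<lambda>x. u x * coef \<nu> \<phi> \<psi> (\<theta> x))
        (\<lambda>n. if n = 0 then f else (\<lambda>_. 0)) (\<lambda>n. if n = 0 then g else (\<lambda>_. 0))"
      unfolding u1 by (rule u_rep)
    from ST[OF H.A_rep_coef[OF \<phi> \<psi>] this] have "l2inner \<nu> (S \<phi>) \<psi> = l2inner \<mu> (T f) g"
      unfolding H.suminf_l2inner_single G.suminf_l2inner_single .
    then have "l2inner \<nu> (S \<phi>) \<psi> \<noteq> 0" using fg by simp
    then show ?thesis unfolding nonzero_op_def by (intro bexI[OF _ \<phi>] bexI[OF _ \<psi>])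
  qed
  ultimately show ?thesis
    unfolding ideal_of_multiplicity_def using S by blast
qed

end

theorem theorem3p5:
  fixes \<mu> :: "'g::{topological_group_add, t2_space, second_countable_topology} measure"
    and \<nu> :: "'h::{topological_group_add, t2_space, second_countable_topology} measure"
    and \<theta> :: "'g \<Rightarrow> 'h"
    and I :: "('h \<Rightarrow> complex) set"
  assumes "lcsc_group TYPE('g)" and "lcsc_group TYPE('h)"
    and "haar_measure \<mu>" and "haar_measure \<nu>"
    and "continuous_on UNIV \<theta>" and "\<And>x y. \<theta> (x + y) = \<theta> x + \<theta> y"
    and "absolutely_continuous \<nu> (distr \<mu> \<nu> \<theta>)"
    and "open (range \<theta>)"
    and "\<And>\<alpha>. \<alpha> \<in> sets borel \<Longrightarrow> \<alpha> \<subseteq> range \<theta> \<Longrightarrow> emeasure (distr \<mu> \<nu> \<theta>) \<alpha> = emeasure \<nu> \<alpha>"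
    and "closed_ideal \<nu> I"
    and "ideal_of_multiplicity \<mu> (rho_star \<mu> \<theta> I)"
  shows "ideal_of_multiplicity \<nu> I"
proof -
  interpret haar_group_hom \<mu> \<nu> \<theta>
    by (rule haar_group_hom.intro[OF haar_group.intro[OF assms(3,1)] haar_group.intro[OF assms(4,2)]
          haar_group_hom_axioms.intro[OF assms(5-7)]])
  show ?thesis
    by (rule ideal_of_multiplicity_transfer[OF assms(11)])
qed

end
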